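(* For every $n\ge1$, the function $H_n(t)$, $t\in(0,1)$, satisfies \begin{align*} &t^2(t-1)^2(H_n'')^2+4t(t-1)(H_n')^3-\Big\{4(2t-1)H_n+[4n^2+4n(\alpha+\beta+\gamma)+(\alpha+\beta)^2]t^2\\ &\quad-2[2n^2+2n(\alpha+\beta+\gamma)+\alpha(\alpha+\gamma)+\beta(\alpha-\gamma)]t+(\alpha+\gamma)^2\Big\}(H_n')^2\\ &+2\Big\{2H_n^2+\big[(4n^2+4n(\alpha+\beta+\gamma)+(\alpha+\beta)^2)t-2n^2-2n(\alpha+\beta+\gamma)-\alpha(\alpha+\gamma)-\beta(\alpha-\gamma)\big]H_n\\ &\quad-n\gamma(n+\alpha+\beta+\gamma)[(\alpha-\beta)t-\alpha-\gamma]\Big\}H_n'-[4n^2+4n(\alpha+\beta+\gamma)+(\alpha+\beta)^2]H_n^2\\ &+2n\gamma(\alpha-\beta)(n+\alpha+\beta+\gamma)H_n-n^2\gamma^2(n+\alpha+\beta+\gamma)^2=0. \end{align*}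
   Context: Fix $\alpha,\beta,\gamma>0$ and real constants $A,B$ with $A\ge0$, $A+B\ge0$, not both $A$ and $A+B$ equal to $0$. Let $\theta$ be the Heaviside function ($\theta(x)=1$ for $x>0$, $0$ otherwise). For $t\in(0,1)$ put $w(x,t)=x^{\alpha}(1-x)^{\beta}|x-t|^{\gamma}(A+B\theta(x-t))$ on $[0,1]$, let $D_n(t)=\det\left(\int_0^1x^{i+j}w(x,t)dx\right)_{i,j=0}^{n-1}$, and $H_n(t)=t(t-1)\frac{d}{dt}\ln D_n(t)$. *)

theory Defs
  imports "HOL-Analysis.Analysis" "Jordan_Normal_Form.Determinant"
begin

definition heaviside :: "real \<Rightarrow> real" where
  "heaviside x = (if x > 0 then 1 else 0)"

definition wgt :: "real \<Rightarrow> real \<Rightarrow> real \<Rightarrow> real \<Rightarrow> real \<Rightarrow> real \<Rightarrow> real \<Rightarrow> real" where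
  "wgt \<alpha> \<beta> \<gamma> A B t x =
     x powr \<alpha> * (1 - x) powr \<beta> * \<bar>x - t\<bar> powr \<gamma> * (A + B * heaviside (x - t))"

definition moment :: "real \<Rightarrow> real \<Rightarrow> real \<Rightarrow> real \<Rightarrow> real \<Rightarrow> nat \<Rightarrow> real \<Rightarrow> real" where
  "moment \<alpha> \<beta> \<gamma> A B k t = integral {0..1} (\<lambda>x. x ^ k * wgt \<alpha> \<beta> \<gamma> A B t x)"

definition hankelD :: "real \<Rightarrow> real \<Rightarrow> real \<Rightarrow> real \<Rightarrow> real \<Rightarrow> nat \<Rightarrow> real \<Rightarrow> real" where
  "hankelD \<alpha> \<beta> \<gamma> A B n t =
     Determinant.det (Matrix.mat n n (\<lambda>(i, j). moment \<alpha> \<beta> \<gamma> A B (i + j) t))"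

definition Hfun :: "real \<Rightarrow> real \<Rightarrow> real \<Rightarrow> real \<Rightarrow> real \<Rightarrow> nat \<Rightarrow> real \<Rightarrow> real" where
  "Hfun \<alpha> \<beta> \<gamma> A B n t = t * (t - 1) * deriv (\<lambda>s. ln (hankelD \<alpha> \<beta> \<gamma> A B n s)) t"

end

theory Submission
  imports Defs
begin

text \<open>
  Write \<open>L q = \<integral> q w\<close> and, for the three nodes \<open>\<nu> = 0, 1, t\<close>
  with exponents \<open>e = \<alpha>, \<beta>, \<gamma>\<close>, \<open>L\<^sub>\<nu> q = e
  \<integral> q w / (x - \<nu>)\<close>, so that \<open>L\<^sub>\<nu> ((x - \<nu>) q) = e L
  q\<close>, \<open>\<Sum>\<^sub>\<nu> L\<^sub>\<nu> q = - L q'\<close> and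
  \<open>\<partial>L/\<partial>t = - L\<^sub>t\<close>. Let \<open>f\<close> be the monic orthogonal
  polynomial of degree \<open>n\<close> and \<open>g\<close> the normalized one of degree \<open>n -
  1\<close>. The numbers \<open>a\<^sub>\<nu> = L\<^sub>\<nu> (f g)\<close>, \<open>b\<^sub>\<nu> =
  L\<^sub>\<nu> (f f)\<close>, \<open>c\<^sub>\<nu> = L\<^sub>\<nu> (g g)\<close> are the entries of
  rank-one residue matrices: \<open>b\<^sub>\<nu> c\<^sub>\<nu> = a\<^sub>\<nu> (a\<^sub>\<nu> -
  e)\<close>, \<open>\<Sum> b\<^sub>\<nu> = \<Sum> c\<^sub>\<nu> = 0\<close>, \<open>\<Sum>
  a\<^sub>\<nu> = - n\<close>, and they obey Schlesinger's equations \<open>(\<nu> - t)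
  a\<^sub>\<nu>' = c\<^sub>t b\<^sub>\<nu> - b\<^sub>t c\<^sub>\<nu>\<close>. The subleading
  coefficient of \<open>f\<close> is \<open>p = a\<^sub>1 + t a\<^sub>t\<close>, and
  \<open>H\<^sub>n\<close> is affine in \<open>p\<close>, hence \<open>H\<^sub>n'\<close> is affine
  in \<open>a\<^sub>t\<close> and \<open>t (t - 1) H\<^sub>n''\<close> is a multiple of the
  commutator entry \<open>c\<^sub>t b\<^sub>1 - b\<^sub>t c\<^sub>1\<close>. Its square is the Gram
  determinant of the residues, a polynomial in the \<open>a\<^sub>\<nu>\<close> alone; this is the
  claimed equation.
\<close>

section \<open>Orthogonal pairs of a moment functional\<close>

definition mfun :: "(nat \<Rightarrow> real) \<Rightarrow> real poly \<Rightarrow> real" where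
  "mfun m p = (\<Sum>i\<le>degree p. coeff p i * m i)"

lemma mfun_le: "degree p \<le> N \<Longrightarrow> mfun m p = (\<Sum>i\<le>N. coeff p i * m i)"
  unfolding mfun_def by (rule sum.mono_neutral_left) (auto simp: coeff_eq_0)

lemma mfun_0 [simp]: "mfun m 0 = 0"
  by (simp add: mfun_def)

lemma mfun_add: "mfun m (p + q) = mfun m p + mfun m q"
proof -
  define N where "N = max (degree p) (degree q)"
  have "degree p \<le> N" "degree q \<le> N" "degree (p + q) \<le> N"
    by (auto simp: N_def intro: degree_add_le)
  then show ?thesis
    by (simp add: mfun_le[of _ N] algebra_simps sum.distrib)
qed

lemma mfun_smult: "mfun m (Polynomial.smult c p) = c * mfun m p"
  using degree_smult_le[of c p]
  by (simp add: mfun_le[of _ "degree p"] sum_distrib_left mult.assoc)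

lemma mfun_minus: "mfun m (- p) = - mfun m p"
  using mfun_smult[of m "-1" p] by simp

lemma mfun_diff: "mfun m (p - q) = mfun m p - mfun m q"
  using mfun_add[of m p "- q"] by (simp add: mfun_minus)

lemma mfun_sum: "mfun m (sum p A) = (\<Sum>i\<in>A. mfun m (p i))"
  by (induction A rule: infinite_finite_induct) (auto simp: mfun_add)

lemma mfun_pCons: "mfun m (pCons a p) = a * m 0 + mfun (\<lambda>k. m (Suc k)) p"
proof -
  have "mfun m (pCons a p) = (\<Sum>i\<le>Suc (degree p). coeff (pCons a p) i * m i)"
    by (rule mfun_le) (rule degree_pCons_le)
  also have "\<dots> = a * m 0 + (\<Sum>i\<le>degree p. coeff p i * m (Suc i))"
    by (subst sum.atMost_Suc_shift) simp
  finally show ?thesis by (simp add: mfun_def)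
qed

lemma mfun_monom: "mfun m (monom c k) = c * m k"
proof -
  have "mfun m (monom c k) = (\<Sum>i\<le>k. if k = i then c * m i else 0)"
    unfolding mfun_le[OF degree_monom_le] by (rule sum.cong) auto
  then show ?thesis by simp
qed

lemma mfun_cmult: "mfun (\<lambda>k. c * m k) p = c * mfun m p"
  by (simp add: mfun_def sum_distrib_left algebra_simps)

lemma mfun_uminus_moments: "mfun (\<lambda>k. - m k) p = - mfun m p"
  by (simp add: mfun_def sum_negf)

lemma mfun_plus_moments: "mfun (\<lambda>k. m k + m' k) p = mfun m p + mfun m' p"
  by (simp add: mfun_def sum.distrib algebra_simps)

lemma mfun_minus_moments: "mfun (\<lambda>k. m k - m' k) p = mfun m p - mfun m' p"
  by (simp add: mfun_def sum_subtractf algebra_simps)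

text \<open>The hypothesis is \<open>(x - a) dLn = e dL\<close> tested on monomials; linearity
  carries it to every \<open>q\<close>. A factor \<open>x - a\<close> thus trades the functional of
  a node for the regular one.\<close>

lemma mfun_linear_mult:
  assumes "\<And>k. mn (Suc k) - a * mn k = e * m k"
  shows "mfun mn ([:-a, 1:] * q) = e * mfun m q"
proof -
  have "mfun mn ([:-a, 1:] * q) = - a * mfun mn q + mfun mn (pCons 0 q)"
    by (simp add: mfun_diff mfun_smult)
  also have "\<dots> = mfun (\<lambda>k. mn (Suc k) - a * mn k) q"
    by (simp add: mfun_pCons mfun_minus_moments mfun_cmult)
  also have "\<dots> = e * mfun m q"
    by (simp add: assms mfun_cmult)
  finally show ?thesis .
qed

text \<open>Moment form of integration by parts without boundary terms. At \<open>k = 0\<close> the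
  truncated index \<open>k - 1\<close> is harmless because of the factor
  \<open>real k\<close>.\<close>

lemma mfun_pderiv_monomials:
  assumes "\<And>k. s k = - (real k * m (k - 1))"
  shows "mfun s q = - mfun m (pderiv q)"
proof -
  have "mfun s q = (\<Sum>i\<le>degree q. coeff q i * s i)"
    by (simp add: mfun_def)
  also have "\<dots> = (\<Sum>i\<le>Suc (degree q). coeff q i * s i)"
    by (simp add: coeff_eq_0)
  also have "\<dots> = - (\<Sum>i\<le>degree q. coeff (pderiv q) i * m i)"
    by (subst sum.atMost_Suc_shift) (simp add: assms coeff_pderiv sum_negf[symmetric] algebra_simps)
  also have "\<dots> = - mfun m (pderiv q)"
    by (simp add: mfun_le[of "pderiv q" "degree q"] degree_pderiv)
  finally show ?thesis .
qed

lemma mfun_mult_expand: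
  assumes "degree r \<le> N"
  shows "mfun m (q * r) = (\<Sum>i\<le>N. coeff r i * mfun m (q * monom 1 i))"
proof -
  have "r = (\<Sum>i\<le>N. Polynomial.smult (coeff r i) (monom 1 i))"
    using poly_as_sum_of_monoms'[OF assms] by (simp add: smult_monom)
  then have "mfun m (q * r) = mfun m (q * (\<Sum>i\<le>N. Polynomial.smult (coeff r i) (monom 1 i)))"
    by simp
  also have "\<dots> = (\<Sum>i\<le>N. coeff r i * mfun m (q * monom 1 i))"
    by (simp add: sum_distrib_left mfun_sum mfun_smult)
  finally show ?thesis .
qed

lemma degree_less_if_coeff_0:
  assumes "n \<ge> 1" "degree r \<le> n" "coeff r n = 0"
  shows "degree r < n"
proof (rule ccontr)
  assume "\<not> degree r < n"
  then have "degree r = n" using assms by simp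
  then have "r = 0" using assms leading_coeff_0_iff by blast
  then show False using assms \<open>degree r = n\<close> by simp
qed

lemma coeff_synthetic_div_top:
  fixes p :: "real poly"
  shows "n \<ge> 1 \<Longrightarrow> degree p \<le> n \<Longrightarrow> coeff (synthetic_div p c) (n - 1) = coeff p n"
proof -
  assume "n \<ge> 1" "degree p \<le> n"
  have "coeff p n = coeff ([:-c, 1:] * synthetic_div p c + [:poly p c:]) n"
    using synthetic_div_correct'[of c p] by simp
  also have "\<dots> = coeff (synthetic_div p c) (n - 1)"
    using \<open>n \<ge> 1\<close> \<open>degree p \<le> n\<close>
    by (cases n) (auto simp: coeff_pCons coeff_eq_0 degree_synthetic_div split: nat.splits)
  finally show ?thesis by simp
qed

text \<open>In the definite case \<open>g\<close> is the orthogonal polynomial of degree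
  \<open>n - 1\<close> divided by its squared norm; with this scaling, pairing with \<open>g\<close>
  reads off the coefficient of degree \<open>n - 1\<close>.\<close>

locale ortho_pair =
  fixes m :: "nat \<Rightarrow> real" and n :: nat and f g :: "real poly"
  assumes n1: "n \<ge> 1"
    and deg_f: "degree f = n" and lead_f: "coeff f n = 1"
    and deg_g: "degree g < n"
    and orth_f: "\<And>r. degree r < n \<Longrightarrow> mfun m (f * r) = 0"
    and orth_g: "\<And>r. degree r < n \<Longrightarrow> mfun m (g * r) = coeff r (n - 1)"
begin

section \<open>Rank-one residues of the pair at a node\<close>

context
  fixes mn :: "nat \<Rightarrow> real" and \<nu> e :: real
  assumes node: "\<And>k. mn (Suc k) - \<nu> * mn k = e * m k"
begin

text \<open>Divide \<open>r\<close> by \<open>x - \<nu>\<close>: the factor \<open>x - \<nu>\<close>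
  turns \<open>mn\<close> into \<open>e m\<close>, so the quotient is seen only by the regular
  functional, where orthogonality applies.\<close>

lemma node_split: "mfun mn (q * r) = poly r \<nu> * mfun mn q + e * mfun m (q * synthetic_div r \<nu>)"
proof -
  have "q * r = q * ([:-\<nu>, 1:] * synthetic_div r \<nu> + [:poly r \<nu>:])"
    by (simp only: synthetic_div_correct')
  also have "\<dots> = [:-\<nu>, 1:] * (q * synthetic_div r \<nu>) + Polynomial.smult (poly r \<nu>) q"
    by (simp add: algebra_simps)
  finally have "mfun mn (q * r) = mfun mn ([:-\<nu>, 1:] * (q * synthetic_div r \<nu>)) + poly r \<nu> * mfun mn q"
    by (simp only: mfun_add mfun_smult)
  then show ?thesis
    by (simp only: mfun_linear_mult[of mn \<nu> e m, OF node])
qed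

lemma node_ff: "poly f \<nu> * mfun mn f = mfun mn (f * f)"
  using node_split[of f f] orth_f[of "synthetic_div f \<nu>"] n1 deg_f
  by (simp add: degree_synthetic_div)

lemma node_fg: "poly g \<nu> * mfun mn f = mfun mn (f * g)"
  using node_split[of f g] orth_f[of "synthetic_div g \<nu>"] n1 deg_g
  by (simp add: degree_synthetic_div)

lemma node_gg: "poly g \<nu> * mfun mn g = mfun mn (g * g)"
proof -
  have "coeff (synthetic_div g \<nu>) (n - 1) = 0"
    using coeff_synthetic_div_top[of n g \<nu>] n1 deg_g by (simp add: coeff_eq_0)
  then show ?thesis
    using node_split[of g g] orth_g[of "synthetic_div g \<nu>"] n1 deg_g
    by (simp add: degree_synthetic_div)
qed

text \<open>The quotient of the monic \<open>f\<close> by \<open>x - \<nu>\<close> has top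
  coefficient 1 in degree \<open>n - 1\<close>, and \<open>orth_g\<close> returns it; among the four
  pairings only this one keeps a regular term.\<close>

lemma node_gf: "poly f \<nu> * mfun mn g = mfun mn (f * g) - e"
proof -
  have "coeff (synthetic_div f \<nu>) (n - 1) = 1"
    using coeff_synthetic_div_top[of n f \<nu>] n1 deg_f lead_f by simp
  then show ?thesis
    using node_split[of g f] orth_g[of "synthetic_div f \<nu>"] n1 deg_f
    by (simp add: degree_synthetic_div mult.commute)
qed

text \<open>Each pairing is a value at \<open>\<nu>\<close> (of \<open>f\<close> or
  \<open>g\<close>) times \<open>mfun mn f\<close> or \<open>mfun mn g\<close>. The 2 by 2 matrix of
  pairings has rank at most one, and its determinant vanishes.\<close>

lemma node_product:
  "mfun mn (f * f) * mfun mn (g * g) = mfun mn (f * g) * (mfun mn (f * g) - e)"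
  by (simp only: node_ff[symmetric] node_gg[symmetric] node_gf[symmetric])
     (simp only: node_fg[symmetric] ac_simps)

end

lemma orth_gf [simp]: "mfun m (f * g) = 0"
  using orth_f deg_g by blast

lemma coeff_pderiv_f: "coeff (pderiv f) (n - 1) = n"
  using n1 lead_f by (cases n) (auto simp: coeff_pderiv)

lemma deg_pderiv: "degree (pderiv f) < n" "degree (pderiv g) < n" 
  using n1 deg_f deg_g by (auto simp: degree_pderiv)

lemma deriv_ff: "mfun m (pderiv (f * f)) = 0"
  using orth_f[OF deg_pderiv(1)]
  by (simp only: pderiv_mult mfun_add)

lemma deriv_gg: "mfun m (pderiv (g * g)) = 0"
proof -
  have "coeff (pderiv g) (n - 1) = 0"
    using n1 deg_g by (cases n) (auto simp: coeff_pderiv coeff_eq_0)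
  then show ?thesis
    using orth_g[OF deg_pderiv(2)]
    by (simp only: pderiv_mult mfun_add)
qed

lemma deriv_fg: "mfun m (pderiv (f * g)) = n"
  using orth_g[OF deg_pderiv(1)] orth_f[OF deg_pderiv(2)]
  by (simp only: pderiv_mult mfun_add coeff_pderiv_f mult.commute[of "pderiv f" g])

text \<open>The operator \<open>x d/dx\<close> multiplies \<open>x^k\<close> by \<open>k\<close>.
  Subtracting \<open>n f\<close> kills the top coefficient and leaves the factor
  \<open>(n - 1) - n = -1\<close> on the next one.\<close>

lemma x_pderiv_f:
  obtains r where "[:0, 1:] * pderiv f = Polynomial.smult (real n) f + r"
    "degree r < n" "coeff r (n - 1) = - coeff f (n - 1)"
proof
  let ?r = "[:0, 1:] * pderiv f - Polynomial.smult (real n) f"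
  show "[:0, 1:] * pderiv f = Polynomial.smult (real n) f + ?r" by simp
  have c: "coeff ?r k = (real k - n) * coeff f k" for k
    by (cases k) (auto simp: coeff_pderiv algebra_simps)
  show "coeff ?r (n - 1) = - coeff f (n - 1)"
    using n1 by (simp only: c) (simp add: of_nat_diff)
  have "degree ?r \<le> n - 1"
  proof (rule degree_le, intro allI impI)
    fix k assume "n - 1 < k"
    then have "k = n \<or> degree f < k" using deg_f by auto
    then show "coeff ?r k = 0"
      by (simp only: c) (auto simp: coeff_eq_0)
  qed
  then show "degree ?r < n" using n1 by simp
qed

lemma deriv_xfg: "mfun m (pderiv ([:0, 1:] * (f * g))) = - coeff f (n - 1)"
proof -
  obtain r where r: "[:0, 1:] * pderiv f = Polynomial.smult (real n) f + r"
    "degree r < n" "coeff r (n - 1) = - coeff f (n - 1)"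
    using x_pderiv_f .
  have p1: "pderiv ([:0, 1:] :: real poly) = 1"
    by (simp add: pderiv_pCons)
  have "pderiv ([:0, 1:] * (f * g)) = f * g + [:0, 1:] * (pderiv f * g + f * pderiv g)"
    by (simp only: pderiv_mult p1) (simp add: algebra_simps)
  also have "\<dots> = f * g + (([:0, 1:] * pderiv f) * g + f * ([:0, 1:] * pderiv g))"
    by (simp add: algebra_simps)
  also have "\<dots> = f * g + (Polynomial.smult (real n) (f * g) + g * r + f * ([:0, 1:] * pderiv g))"
    by (simp only: r) (simp add: algebra_simps)
  finally have "mfun m (pderiv ([:0, 1:] * (f * g))) =
      mfun m (g * r) + mfun m (f * ([:0, 1:] * pderiv g))"
    by (simp only: mfun_add mfun_smult orth_gf)
  moreover have "degree ([:0, 1:] * pderiv g) < n"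
    using n1 deg_g pderiv_eq_0_iff[of g]
    by (cases "pderiv g = 0") (auto simp: degree_mult_eq degree_pderiv)
  ultimately show ?thesis
    by (simp only: orth_g[OF r(2)] orth_f r(3))
qed

end

section \<open>Coefficientwise differentiation in a parameter\<close>

definition coeffs_deriv :: "(real \<Rightarrow> real poly) \<Rightarrow> real poly \<Rightarrow> real \<Rightarrow> bool" where
  "coeffs_deriv q qd t \<longleftrightarrow> (\<forall>i. ((\<lambda>s. coeff (q s) i) has_real_derivative coeff qd i) (at t))"

lemma coeffs_deriv_const: "coeffs_deriv (\<lambda>s. q) 0 t"
  by (simp add: coeffs_deriv_def)

lemma coeffs_deriv_mult:
  assumes "coeffs_deriv q qd t" "coeffs_deriv r rd t"
  shows "coeffs_deriv (\<lambda>s. q s * r s) (qd * r t + q t * rd) t"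
  using assms unfolding coeffs_deriv_def
  by (auto simp: coeff_mult sum.distrib[symmetric] intro!: derivative_eq_intros sum.cong)

lemma coeffs_deriv_exists:
  assumes deg: "\<And>s. degree (q s) \<le> N"
    and diff: "\<And>i. (\<lambda>s. coeff (q s) i) field_differentiable at t"
  shows "\<exists>qd. coeffs_deriv q qd t \<and> degree qd \<le> N"
proof -
  define qd where "qd = (\<Sum>i\<le>N. monom (deriv (\<lambda>s. coeff (q s) i) t) i)"
  have c: "coeff qd i = deriv (\<lambda>s. coeff (q s) i) t" for i
  proof (cases "i \<le> N")
    case True
    then show ?thesis by (simp add: qd_def coeff_sum)
  next
    case False
    then have "coeff (q s) i = 0" for s
      using deg[of s] by (intro coeff_eq_0) linarith
    then show ?thesis using False by (simp add: qd_def coeff_sum)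
  qed
  have "coeffs_deriv q qd t"
    using diff by (simp add: coeffs_deriv_def c field_differentiable_derivI)
  moreover have "degree qd \<le> N"
    unfolding qd_def by (intro degree_sum_le) (auto intro: order_trans[OF degree_monom_le])
  ultimately show ?thesis by blast
qed

text \<open>The sum in \<open>mfun\<close> runs up to the degree of \<open>q s\<close>, which may
  vary with \<open>s\<close>; the uniform bound \<open>N\<close> gives a fixed finite sum, to which
  the product rule applies termwise.\<close>

lemma DERIV_mfun:
  assumes deg: "\<And>s. degree (q s) \<le> N" "degree qd \<le> N"
    and m: "\<And>i. ((\<lambda>s. m s i) has_real_derivative m' i) (at t)"
    and q: "coeffs_deriv q qd t"
  shows "((\<lambda>s. mfun (m s) (q s)) has_real_derivative mfun m' (q t) + mfun (m t) qd) (at t)"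
  unfolding mfun_le[OF deg(1)] mfun_le[OF deg(2)]
  using q unfolding coeffs_deriv_def
  by (auto intro!: derivative_eq_intros m sum.cong simp: sum.distrib[symmetric] algebra_simps)

section \<open>The Christoffel-Darboux kernel and its pairing with a node\<close>

context ortho_pair
begin

lemma orth_f_top:
  assumes "degree r \<le> n"
  shows "mfun m (f * r) = coeff r n * mfun m (f * f)"
proof -
  let ?r = "r - Polynomial.smult (coeff r n) f"
  have "degree ?r < n"
  proof -
    have "degree ?r \<le> n" using assms deg_f by (intro degree_diff_le) auto
    moreover have "coeff ?r n = 0" by (simp add: lead_f)
    ultimately show ?thesis
      using n1 degree_less_if_coeff_0 by blast
  qed
  from orth_f[OF this] show ?thesis
    by (simp add: right_diff_distrib mfun_diff mfun_smult)
qed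

text \<open>
  The hypothesis makes \<open>d\<close> the \<open>C\<close>-fold reproducing kernel at \<open>t\<close>, so this is the Christoffel--Darboux
  formula.
\<close>

lemma evaluation_kernel:
  assumes definite: "\<And>q. q \<noteq> 0 \<Longrightarrow> mfun m (q * q) \<noteq> 0"
    and d: "degree d < n" "\<And>r. degree r < n \<Longrightarrow> mfun m (d * r) = poly r t * C"
  shows "[:-t, 1:] * d = Polynomial.smult (C * poly g t) f - Polynomial.smult (C * poly f t) g"
proof -
  have coeff_x: "coeff ([:-t, 1:] * r) n = coeff r (n - 1)" if "degree r < n" for r
    using n1 that by (cases n) (auto simp: coeff_eq_0)
  have deg_x: "degree ([:-t, 1:] * r) \<le> n" if "degree r < n" for r
    using that degree_mult_le[of "[:-t, 1:]" r] by simp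
  have less: "degree r < n" if "degree r \<le> n" "coeff r n = 0" for r :: "real poly"
    using n1 that by (rule degree_less_if_coeff_0)
  \<comment> \<open>The defect of the claimed formula. It has degree below \<open>n\<close> and is
    orthogonal to all such polynomials, hence to itself, so \<open>definite\<close> makes it
    zero.\<close>
  define q where "q = [:-t, 1:] * d - (Polynomial.smult (C * poly g t) f - Polynomial.smult (C * poly f t) g)"
  have "coeff d (n - 1) = C * poly g t"
    using orth_g[OF d(1)] d(2)[OF deg_g] by (simp add: mult.commute)
  then have "coeff q n = 0"
    using coeff_x[OF d(1)] deg_g lead_f unfolding q_def
    by (simp del: mult_pCons_left add: coeff_eq_0)
  moreover have "degree q \<le> n"
    unfolding q_def using deg_x[OF d(1)] deg_f deg_g
    by (intro degree_diff_le) (auto intro: order_trans[OF degree_smult_le])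
  ultimately have deg_q: "degree q < n" by (rule less[rotated])
  have "mfun m (q * r) = 0" if r: "degree r < n" for r
  proof -
    define c where "c = coeff r (n - 1)"
    \<comment> \<open>\<open>(x - t) r\<close> is reduced modulo \<open>f\<close> to degree below
      \<open>n\<close>, where the kernel property of \<open>d\<close> applies; at \<open>t\<close>
      only \<open>- c f(t)\<close> remains.\<close>
    define r2 where "r2 = [:-t, 1:] * r - Polynomial.smult c f"
    have "degree r2 < n"
    proof (rule less)
      show "degree r2 \<le> n"
        unfolding r2_def using deg_x[OF r] deg_f
        by (intro degree_diff_le) (auto intro: order_trans[OF degree_smult_le])
      show "coeff r2 n = 0"
        unfolding r2_def using coeff_x[OF r] lead_f c_def by (simp del: mult_pCons_left)
    qed
    then have "mfun m (d * r2) = - c * poly f t * C"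
      by (subst d(2)) (simp_all add: r2_def)
    moreover have "mfun m (d * f) = 0"
      using orth_f[OF d(1)] by (simp add: mult.commute)
    moreover have "[:-t, 1:] * d * r = d * r2 + Polynomial.smult c (d * f)"
      by (simp add: r2_def algebra_simps)
    ultimately have "mfun m ([:-t, 1:] * d * r) = - c * poly f t * C"
      by (simp only: mfun_add mfun_smult)
    moreover have "q * r = [:-t, 1:] * d * r
        - (Polynomial.smult (C * poly g t) (f * r) - Polynomial.smult (C * poly f t) (g * r))"
      by (simp add: q_def algebra_simps)
    ultimately show ?thesis
      using orth_f[OF r] orth_g[OF r] by (simp only: mfun_diff mfun_smult) (simp add: c_def)
  qed
  then have "mfun m (q * q) = 0" using deg_q by blast
  then have "q = 0" using definite by blast
  then show ?thesis by (simp add: q_def)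
qed

text \<open>Evaluate \<open>mn\<close> on \<open>(x - t) d q\<close> twice: through
  \<open>x - t = (x - \<nu>) + (\<nu> - t)\<close>, and through the Christoffel-Darboux form of
  \<open>(x - t) d\<close>.\<close>

lemma node_kernel:
  assumes node: "\<And>k. mn (Suc k) - \<nu> * mn k = e * m k"
    and definite: "\<And>q. q \<noteq> 0 \<Longrightarrow> mfun m (q * q) \<noteq> 0"
    and d: "degree d < n" "\<And>r. degree r < n \<Longrightarrow> mfun m (d * r) = poly r t * C"
  shows "(\<nu> - t) * mfun mn (d * q) =
    C * (poly g t * mfun mn (f * q) - poly f t * mfun mn (g * q)) - e * mfun m (d * q)"
proof -
  have "[:-t, 1:] * (d * q) = [:-\<nu>, 1:] * (d * q) + Polynomial.smult (\<nu> - t) (d * q)"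
    by (simp add: algebra_simps smult_diff_left)
  then have "mfun mn ([:-t, 1:] * (d * q)) = e * mfun m (d * q) + (\<nu> - t) * mfun mn (d * q)"
    by (simp only: mfun_add mfun_smult mfun_linear_mult[of mn \<nu> e m, OF node])
  moreover have "[:-t, 1:] * (d * q) =
      (Polynomial.smult (C * poly g t) f - Polynomial.smult (C * poly f t) g) * q"
    by (subst evaluation_kernel[OF definite d, symmetric]) (simp_all only: mult.assoc simp_thms)
  then have "mfun mn ([:-t, 1:] * (d * q)) =
      C * poly g t * mfun mn (f * q) - C * poly f t * mfun mn (g * q)"
    by (simp only: left_diff_distrib mult_smult_left mfun_diff mfun_smult)
  ultimately show ?thesis by (simp add: algebra_simps)
qed

end

section \<open>Deformation of the orthogonal polynomials\<close>

lemma det_field_differentiable: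
  fixes A :: "real \<Rightarrow> real mat"
  assumes "\<And>s. A s \<in> carrier_mat n n"
    and "\<And>i j. i < n \<Longrightarrow> j < n \<Longrightarrow> (\<lambda>s. A s $$ (i, j)) field_differentiable at t"
  shows "(\<lambda>s. Determinant.det (A s)) field_differentiable at t"
proof -
  have "\<exists>D. ((\<lambda>s. \<Prod>i = 0..<n. A s $$ (i, p i)) has_field_derivative D) (at t)"
    if "p permutes {0..<n}" for p
  proof -
    have "(\<lambda>s. A s $$ (i, p i)) field_differentiable at t" if "i \<in> {0..<n}" for i
      using that assms(2) permutes_in_image[OF \<open>p permutes {0..<n}\<close>, of i] by auto
    then have "\<And>i. i \<in> {0..<n} \<Longrightarrow>
        ((\<lambda>s. A s $$ (i, p i)) has_field_derivative deriv (\<lambda>s. A s $$ (i, p i)) t) (at t)"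
      by (simp add: field_differentiable_derivI)
    from has_field_derivative_prod[where f = "\<lambda>i s. A s $$ (i, p i)", OF this]
    show ?thesis by (rule exI)
  qed
  then have "(\<lambda>s. \<Prod>i = 0..<n. A s $$ (i, p i)) field_differentiable at t"
    if "p \<in> {p. p permutes {0..<n}}" for p
    using that by (auto simp: field_differentiable_def)
  then show ?thesis
    unfolding det_def'[OF assms(1)]
    by (intro field_differentiable_sum field_differentiable_mult) auto
qed

lemma eventually_at_interval:
  "t \<in> {a<..<b::real} \<Longrightarrow> (\<And>s. s \<in> {a<..<b} \<Longrightarrow> P s) \<Longrightarrow> eventually P (nhds t)"
  using eventually_nhds_in_open[of "{a<..<b}" t] by (auto elim: eventually_mono)

lemma DERIV_interval_cong:
  assumes "(f has_real_derivative d) (at t)" "t \<in> {a<..<b::real}"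
    "\<And>s. s \<in> {a<..<b} \<Longrightarrow> g s = f s"
  shows "(g has_real_derivative d) (at t)"
  using assms DERIV_cong_ev[OF refl eventually_at_interval[of t a b "\<lambda>s. g s = f s"] refl]
  by blast

text \<open>\<open>shift\<close> is the moment form of \<open>(x - t) dw/dt = - \<gamma> w\<close>.
  \<open>gauss\<close> is a contiguity relation expressing the derivative by two neighbouring
  moments. \<open>definite\<close> makes the Hankel determinants positive.\<close>

locale jacobi_moments =
  fixes \<alpha> \<beta> \<gamma> :: real and \<mu> \<mu>' :: "real \<Rightarrow> nat \<Rightarrow> real"
  assumes der: "t \<in> {0<..<1} \<Longrightarrow> ((\<lambda>s. \<mu> s k) has_real_derivative \<mu>' t k) (at t)"
    and shift: "t \<in> {0<..<1} \<Longrightarrow> \<mu>' t (Suc k) = t * \<mu>' t k - \<gamma> * \<mu> t k"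
    and gauss: "t \<in> {0<..<1} \<Longrightarrow> t * (1 - t) * \<mu>' t k =
      (k + 1 + \<alpha> + \<gamma> * (1 - t)) * \<mu> t k - (k + 2 + \<alpha> + \<beta> + \<gamma>) * \<mu> t (Suc k)"
    and definite: "t \<in> {0<..<1} \<Longrightarrow> q \<noteq> 0 \<Longrightarrow> mfun (\<mu> t) (q * q) > 0"
begin

text \<open>
  Moments of the functionals \<open>L\<^sub>t\<close>, \<open>L\<^sub>1\<close>, \<open>L\<^sub>0\<close>, written through \<open>\<mu>\<close> and \<open>\<mu>'\<close> so that the singular integrals
  \<open>\<integral> q w / (x - \<nu>)\<close> never occur.
\<close>

definition \<mu>t :: "real \<Rightarrow> nat \<Rightarrow> real" where
  "\<mu>t t k = - \<mu>' t k"

definition \<mu>1 :: "real \<Rightarrow> nat \<Rightarrow> real" where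
  "\<mu>1 t k = t * \<mu>' t k - (k + 1 + \<alpha> + \<beta> + \<gamma>) * \<mu> t k"

definition \<mu>0 :: "real \<Rightarrow> nat \<Rightarrow> real" where
  "\<mu>0 t k = (k + 1 + \<alpha> + \<beta> + \<gamma>) * \<mu> t k + (1 - t) * \<mu>' t k - k * \<mu> t (k - 1)"

lemma node_t: "t \<in> {0<..<1} \<Longrightarrow> \<mu>t t (Suc k) - t * \<mu>t t k = \<gamma> * \<mu> t k"
  by (simp add: \<mu>t_def shift)

lemma node_1: "t \<in> {0<..<1} \<Longrightarrow> \<mu>1 t (Suc k) - 1 * \<mu>1 t k = \<beta> * \<mu> t k"
  using gauss[of t k] by (simp add: \<mu>1_def shift) (simp add: algebra_simps)

lemma node_0: "t \<in> {0<..<1} \<Longrightarrow> \<mu>0 t (Suc k) - 0 * \<mu>0 t k = \<alpha> * \<mu> t k"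
  using gauss[of t k] by (simp add: \<mu>0_def shift) (simp add: algebra_simps)

text \<open>Integration of \<open>(q w)'\<close> with
  \<open>w'/w = \<alpha>/x + \<beta>/(x - 1) + \<gamma>/(x - t)\<close>. On moments everything
  cancels except the last term of \<open>\<mu>0\<close>.\<close>

lemma parts: "mfun (\<mu>0 t) q + mfun (\<mu>1 t) q + mfun (\<mu>t t) q = - mfun (\<mu> t) (pderiv q)"
proof -
  have "mfun (\<mu>0 t) q + mfun (\<mu>1 t) q + mfun (\<mu>t t) q = mfun (\<lambda>k. \<mu>0 t k + \<mu>1 t k + \<mu>t t k) q"
    by (simp add: mfun_plus_moments)
  also have "\<dots> = - mfun (\<mu> t) (pderiv q)"
    by (rule mfun_pderiv_monomials) (simp add: \<mu>0_def \<mu>1_def \<mu>t_def algebra_simps)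
  finally show ?thesis .
qed

text \<open>Differentiating \<open>w / (x - 1)\<close> in \<open>t\<close> produces
  \<open>1 / ((x - 1) (x - t))\<close>; its partial fractions give the right-hand side.\<close>

lemma DERIV_\<mu>1:
  assumes t: "t \<in> {0<..<1}"
  shows "((\<lambda>s. \<mu>1 s k) has_real_derivative (\<beta> * \<mu>t t k - \<gamma> * \<mu>1 t k) / (1 - t)) (at t)"
proof (rule DERIV_interval_cong[OF _ t])
  \<comment> \<open>Differentiability of \<open>\<mu>'\<close> is not among the assumptions, so
    \<open>gauss\<close> eliminates it: \<open>?F\<close> involves only \<open>\<mu>\<close>, at the
    cost of the denominator \<open>1 - s\<close>.\<close>
  let ?F = "\<lambda>s. ((k + 1 + \<alpha> + \<gamma> * (1 - s) - (1 - s) * (k + 1 + \<alpha> + \<beta> + \<gamma>)) * \<mu> s k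
    - (k + 2 + \<alpha> + \<beta> + \<gamma>) * \<mu> s (Suc k)) / (1 - s)"
  have F: "\<mu>1 s k = ?F s" if "s \<in> {0<..<1}" for s
    using that gauss[OF that, of k] by (simp add: \<mu>1_def field_simps)
  then show "\<And>s. s \<in> {0<..<1} \<Longrightarrow> \<mu>1 s k = ?F s" .
  let ?N = "(k + 1 + \<alpha> + \<gamma> * (1 - t) - (1 - t) * (k + 1 + \<alpha> + \<beta> + \<gamma>)) * \<mu> t k
    - (k + 2 + \<alpha> + \<beta> + \<gamma>) * \<mu> t (Suc k)"
  let ?N' = "(k + 1 + \<alpha> + \<beta>) * \<mu> t k
      + (k + 1 + \<alpha> + \<gamma> * (1 - t) - (1 - t) * (k + 1 + \<alpha> + \<beta> + \<gamma>)) * \<mu>' t k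
      - (k + 2 + \<alpha> + \<beta> + \<gamma>) * \<mu>' t (Suc k)"
  have N: "?N = (1 - t) * \<mu>1 t k"
    using t F[OF t] by (simp add: field_simps)
  have "(?F has_real_derivative (?N' * (1 - t) + ?N) / ((1 - t) * (1 - t))) (at t)"
    using t by (auto intro!: derivative_eq_intros der simp: algebra_simps)
  moreover have "?N' * (1 - t) + ?N = (1 - t) * (\<beta> * \<mu>t t k - \<gamma> * \<mu>1 t k)"
  proof -
    have "?N' + \<mu>1 t k = \<beta> * \<mu>t t k - \<gamma> * \<mu>1 t k"
      unfolding shift[OF t] \<mu>1_def \<mu>t_def by (simp add: algebra_simps)
    moreover have "x * (1 - t) + (1 - t) * y = (1 - t) * (x + y)" for x y
      by (simp add: distrib_left mult.commute)
    ultimately show ?thesis unfolding N by (simp only:)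
  qed
  ultimately show "(?F has_real_derivative (\<beta> * \<mu>t t k - \<gamma> * \<mu>1 t k) / (1 - t)) (at t)"
    using t by simp
qed

section \<open>Orthogonal polynomials from Hankel cofactors\<close>

definition hank :: "nat \<Rightarrow> real \<Rightarrow> real mat" where
  "hank N s = Matrix.mat N N (\<lambda>(i, j). \<mu> s (i + j))"

definition D :: "nat \<Rightarrow> real \<Rightarrow> real" where
  "D N s = Determinant.det (hank N s)"

text \<open>
  The last row of cofactors of a Hankel matrix gives the orthogonal polynomial scaled to have leading
  coefficient \<open>D N s\<close>; its coefficients are visibly differentiable in \<open>s\<close>.
\<close>

definition \<phi> :: "nat \<Rightarrow> real \<Rightarrow> real poly" where
  "\<phi> N s = (\<Sum>j\<le>N. monom (cofactor (hank (Suc N) s) N j) j)"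

lemma hank_carrier [simp]: "hank N s \<in> carrier_mat N N"
  by (simp add: hank_def)

lemma degree_\<phi>: "degree (\<phi> N s) \<le> N"
  unfolding \<phi>_def by (intro degree_sum_le) (auto intro: order_trans[OF degree_monom_le])

lemma coeff_\<phi>: "coeff (\<phi> N s) j = (if j \<le> N then cofactor (hank (Suc N) s) N j else 0)"
  by (simp add: \<phi>_def coeff_sum)

lemma coeff_\<phi>_top: "coeff (\<phi> N s) N = D N s"
proof -
  have "mat_delete (hank (Suc N) s) N N = hank N s"
    by (rule eq_matI) (auto simp: mat_delete_def hank_def)
  then show ?thesis by (simp add: coeff_\<phi> cofactor_def D_def)
qed

text \<open>This is entry \<open>(i, N)\<close> of \<open>M adj M = (det M) I\<close> for the Hankel
  matrix \<open>M\<close> of size \<open>N + 1\<close>.\<close>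

lemma mfun_\<phi>_monom:
  assumes "i \<le> N"
  shows "mfun (\<mu> s) (\<phi> N s * monom 1 i) = (if i = N then D (Suc N) s else 0)"
proof -
  let ?M = "hank (Suc N) s"
  have "\<phi> N s * monom 1 i = (\<Sum>j\<le>N. monom (cofactor ?M N j) (i + j))"
    by (simp add: \<phi>_def sum_distrib_right mult_monom add.commute)
  then have "mfun (\<mu> s) (\<phi> N s * monom 1 i) = (\<Sum>j\<le>N. cofactor ?M N j * \<mu> s (i + j))"
    by (simp add: mfun_sum mfun_monom)
  also have "\<dots> = (\<Sum>j = 0..<Suc N. ?M $$ (i, j) * adj_mat ?M $$ (j, N))"
    using assms
    by (intro sum.cong) (auto simp: adj_mat_def hank_def mult.commute)
  also have "\<dots> = (?M * adj_mat ?M) $$ (i, N)"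
    using assms adj_mat(1)[of ?M "Suc N"]
    by (simp add: scalar_prod_def hank_def)
  also have "\<dots> = (if i = N then D (Suc N) s else 0)"
    using assms adj_mat(2)[of ?M "Suc N"] by (simp add: D_def)
  finally show ?thesis .
qed

lemma mfun_\<phi>:
  assumes "degree r \<le> N"
  shows "mfun (\<mu> s) (\<phi> N s * r) = coeff r N * D (Suc N) s"
  unfolding mfun_mult_expand[OF assms]
  by (simp add: mfun_\<phi>_monom if_distrib cong: if_cong)

text \<open>The squared norm of \<open>\<phi> N s\<close> is \<open>D N s * D (Suc N) s\<close>, so
  positivity passes from one determinant to the next.\<close>

lemma D_pos: "s \<in> {0<..<1} \<Longrightarrow> D N s > 0"
proof (induction N)
  case 0
  then show ?case by (simp add: D_def hank_def)
next
  case (Suc N)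
  then have "D N s > 0" by simp
  then have "\<phi> N s \<noteq> 0" using coeff_\<phi>_top[of N s] by auto
  then have "0 < mfun (\<mu> s) (\<phi> N s * \<phi> N s)" using definite Suc.prems by blast
  also have "\<dots> = D N s * D (Suc N) s"
    by (subst mfun_\<phi>) (auto simp: degree_\<phi> coeff_\<phi>_top)
  finally show ?case using \<open>D N s > 0\<close> by (simp add: zero_less_mult_iff)
qed

lemma D_differentiable: "t \<in> {0<..<1} \<Longrightarrow> D N field_differentiable at t"
  unfolding D_def
  by (rule det_field_differentiable[of _ N])
     (auto simp: hank_def field_differentiable_def intro!: exI der)

lemma coeff_\<phi>_differentiable:
  assumes "t \<in> {0<..<1}"
  shows "(\<lambda>s. coeff (\<phi> N s) j) field_differentiable at t"
proof (cases "j \<le> N")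
  case True
  have "(\<lambda>s. mat_delete (hank (Suc N) s) N j $$ (i, k)) field_differentiable at t"
    if "i < N" "k < N" for i k
    using that assms
    by (auto simp: mat_delete_def hank_def field_differentiable_def intro!: exI der)
  then have "(\<lambda>s. Determinant.det (mat_delete (hank (Suc N) s) N j)) field_differentiable at t"
    using mat_delete_carrier[OF hank_carrier, of "Suc N"]
    by (intro det_field_differentiable[of _ N]) auto
  then show ?thesis
    using True by (simp add: coeff_\<phi> cofactor_def field_differentiable_mult)
next
  case False
  then show ?thesis by (simp add: coeff_\<phi>)
qed

end

text \<open>Prepares the integration by parts of \<open>x (x - 1) f f\<close>;
  \<open>[:0, -1, 1:]\<close> is \<open>x (x - 1)\<close>. With \<open>x f' = n f + r\<close>, the
  product \<open>(x - 1) r\<close> has degree at most \<open>n\<close>, and only its top coefficient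
  survives against \<open>f\<close>.\<close>

lemma (in ortho_pair) mfun_x_pderiv_ff:
  "mfun m (f * ([:0, -1, 1:] * pderiv f)) =
    n * mfun m ([:0, 1:] * (f * f)) - (n + coeff f (n - 1)) * mfun m (f * f)"
proof -
  obtain r where r: "[:0, 1:] * pderiv f = Polynomial.smult (real n) f + r"
    "degree r < n" "coeff r (n - 1) = - coeff f (n - 1)"
    using x_pderiv_f .
  have "[:0, -1, 1:] = [:-1, 1:] * [:0, 1::real:]" by simp
  then have "f * ([:0, -1, 1:] * pderiv f) = f * ([:-1, 1:] * ([:0, 1:] * pderiv f))"
    by (simp only: mult.assoc)
  also have "\<dots> = Polynomial.smult (real n) ([:0, 1:] * (f * f))
      - Polynomial.smult (real n) (f * f) + f * ([:-1, 1:] * r)"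
    by (simp only: r) (simp add: algebra_simps smult_diff_right)
  finally have "mfun m (f * ([:0, -1, 1:] * pderiv f)) =
      n * mfun m ([:0, 1:] * (f * f)) - n * mfun m (f * f) + mfun m (f * ([:-1, 1:] * r))"
    by (simp only: mfun_add mfun_diff mfun_smult)
  moreover have "degree ([:-1, 1:] * r) \<le> n"
    using r(2) degree_mult_le[of "[:-1, 1:]" r] by simp
  moreover have "coeff ([:-1, 1:] * r) n = - coeff f (n - 1)"
    using n1 r(2,3) by (cases n) (auto simp: coeff_eq_0)
  ultimately show ?thesis
    by (simp only: orth_f_top) (simp add: algebra_simps)
qed

section \<open>Normalized polynomials and their derivatives in \<open>t\<close>\<close>

context jacobi_moments
begin

definition f :: "nat \<Rightarrow> real \<Rightarrow> real poly" where
  "f n s = Polynomial.smult (1 / D n s) (\<phi> n s)"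

text \<open>Pairing \<open>\<phi> (n - 1) s\<close> with \<open>x^(n - 1)\<close> gives
  \<open>D n s\<close>, whence this divisor.\<close>

definition g :: "nat \<Rightarrow> real \<Rightarrow> real poly" where
  "g n s = Polynomial.smult (1 / D n s) (\<phi> (n - 1) s)"

definition p :: "nat \<Rightarrow> real \<Rightarrow> real" where
  "p n s = coeff (f n s) (n - 1)"

lemma degree_f_le: "degree (f n s) \<le> n"
  unfolding f_def using degree_\<phi> degree_smult_le order_trans by blast

lemma degree_g_le: "degree (g n s) \<le> n - 1"
  unfolding g_def using degree_\<phi> degree_smult_le order_trans by blast

lemma ortho_pair_fg:
  assumes "n \<ge> 1" "s \<in> {0<..<1}"
  shows "ortho_pair (\<mu> s) n (f n s) (g n s)"
proof
  have D: "D n s > 0" using D_pos assms by blast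
  show "n \<ge> 1" by fact
  show lead: "coeff (f n s) n = 1"
    using D by (simp add: f_def coeff_\<phi>_top)
  show "degree (f n s) = n"
    using degree_f_le le_degree[of "f n s" n] lead by (simp add: antisym)
  show "degree (g n s) < n"
    using degree_g_le[of n s] assms by linarith
  fix r :: "real poly" assume r: "degree r < n"
  show "mfun (\<mu> s) (f n s * r) = 0"
    using r by (simp add: f_def mfun_smult mfun_\<phi> coeff_eq_0)
  show "mfun (\<mu> s) (g n s * r) = coeff r (n - 1)"
    using r D assms by (simp add: g_def mfun_smult mfun_\<phi>)
qed

lemma mfun_ff:
  assumes "n \<ge> 1" "s \<in> {0<..<1}"
  shows "mfun (\<mu> s) (f n s * f n s) = D (Suc n) s / D n s"
proof -
  interpret ortho_pair "\<mu> s" n "f n s" "g n s" by (rule ortho_pair_fg[OF assms])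
  show ?thesis
    using mfun_\<phi>[of "f n s" n s] lead_f deg_f by (simp add: f_def mfun_smult)
qed

text \<open>Differentiating the orthogonality relation moves the derivative \<open>- \<mu>t\<close>
  of the moments onto \<open>fd\<close>, and division of \<open>r\<close> by \<open>x - t\<close>
  leaves only \<open>r(t)\<close>: \<open>fd\<close> is a multiple of the evaluation kernel at
  \<open>t\<close>. Its degree drops because \<open>f\<close> stays monic.\<close>

lemma coeffs_deriv_f:
  assumes n: "n \<ge> 1" and t: "t \<in> {0<..<1}"
  shows "\<exists>fd. coeffs_deriv (f n) fd t \<and> degree fd < n \<and>
    (\<forall>r. degree r < n \<longrightarrow> mfun (\<mu> t) (fd * r) = poly r t * mfun (\<mu>t t) (f n t))"
proof -
  interpret ortho_pair "\<mu> t" n "f n t" "g n t" by (rule ortho_pair_fg[OF assms])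
  have "(\<lambda>s. coeff (f n s) i) field_differentiable at t" for i
    unfolding f_def using D_pos[OF t, of n]
    by (auto intro!: field_differentiable_mult field_differentiable_divide
        D_differentiable coeff_\<phi>_differentiable t)
  from coeffs_deriv_exists[OF degree_f_le this] obtain fd where
    fd: "coeffs_deriv (f n) fd t" "degree fd \<le> n"
    by blast
  have "((\<lambda>s. coeff (f n s) n) has_real_derivative 0) (at t)"
    by (rule DERIV_interval_cong[OF DERIV_const[of 1] t]) (use ortho_pair_fg[OF n] ortho_pair.lead_f in blast)
  then have "coeff fd n = 0"
    using fd(1) DERIV_unique unfolding coeffs_deriv_def by blast
  then have deg: "degree fd < n"
    using fd(2) n degree_less_if_coeff_0 by blast
  have "mfun (\<mu> t) (fd * r) = poly r t * mfun (\<mu>t t) (f n t)" if r: "degree r < n" for r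
  proof -
    have cd: "coeffs_deriv (\<lambda>s. f n s * r) (fd * r) t"
      using coeffs_deriv_mult[OF fd(1) coeffs_deriv_const[of r t]] by simp
    have "degree (f n s * r) \<le> n + degree r" for s
      using degree_mult_le[of "f n s" r] degree_f_le[of n s] by linarith
    moreover have "degree (fd * r) \<le> n + degree r"
      using degree_mult_le[of fd r] fd(2) by linarith
    ultimately have "((\<lambda>s. mfun (\<mu> s) (f n s * r)) has_real_derivative
        mfun (\<mu>' t) (f n t * r) + mfun (\<mu> t) (fd * r)) (at t)"
      by (intro DERIV_mfun[of _ "n + degree r"] der t cd) auto
    moreover have "((\<lambda>s. mfun (\<mu> s) (f n s * r)) has_real_derivative 0) (at t)"
      by (rule DERIV_interval_cong[OF DERIV_const[of 0] t])
         (use ortho_pair_fg[OF n] ortho_pair.orth_f r in blast)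
    ultimately have "mfun (\<mu>' t) (f n t * r) + mfun (\<mu> t) (fd * r) = 0"
      by (rule DERIV_unique)
    moreover have "mfun (\<mu>t t) (f n t * r) = - mfun (\<mu>' t) (f n t * r)"
      unfolding \<mu>t_def[abs_def] by (rule mfun_uminus_moments)
    moreover have "mfun (\<mu>t t) (f n t * r) = poly r t * mfun (\<mu>t t) (f n t)"
      using node_split[of "\<mu>t t" t \<gamma>, OF node_t[OF t], of "f n t" r] orth_f[of "synthetic_div r t"] r
      by (simp add: degree_synthetic_div)
    ultimately show ?thesis by simp
  qed
  with fd(1) deg show ?thesis by blast
qed

text \<open>As for \<open>f\<close>: the pairing with \<open>r\<close> now has the value
  \<open>coeff r (n - 1)\<close>, which is still constant in \<open>s\<close>.\<close>

lemma coeffs_deriv_g: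
  assumes n: "n \<ge> 1" and t: "t \<in> {0<..<1}"
  shows "\<exists>gd. coeffs_deriv (g n) gd t \<and> degree gd < n \<and>
    (\<forall>r. degree r < n \<longrightarrow> mfun (\<mu> t) (gd * r) = poly r t * mfun (\<mu>t t) (g n t))"
proof -
  interpret ortho_pair "\<mu> t" n "f n t" "g n t" by (rule ortho_pair_fg[OF assms])
  have "(\<lambda>s. coeff (g n s) i) field_differentiable at t" for i
    unfolding g_def using D_pos[OF t, of n]
    by (auto intro!: field_differentiable_mult field_differentiable_divide
        D_differentiable coeff_\<phi>_differentiable t)
  from coeffs_deriv_exists[OF degree_g_le this] obtain gd where
    gd: "coeffs_deriv (g n) gd t" "degree gd \<le> n - 1"
    by blast
  then have deg: "degree gd < n" using n by linarith
  have "mfun (\<mu> t) (gd * r) = poly r t * mfun (\<mu>t t) (g n t)" if r: "degree r < n" for r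
  proof -
    have cd: "coeffs_deriv (\<lambda>s. g n s * r) (gd * r) t"
      using coeffs_deriv_mult[OF gd(1) coeffs_deriv_const[of r t]] by simp
    have "degree (g n s * r) \<le> n + degree r" for s
      using degree_mult_le[of "g n s" r] degree_g_le[of n s] by linarith
    moreover have "degree (gd * r) \<le> n + degree r"
      using degree_mult_le[of gd r] gd(2) by linarith
    ultimately have "((\<lambda>s. mfun (\<mu> s) (g n s * r)) has_real_derivative
        mfun (\<mu>' t) (g n t * r) + mfun (\<mu> t) (gd * r)) (at t)"
      by (intro DERIV_mfun[of _ "n + degree r"] der t cd) auto
    moreover have "((\<lambda>s. mfun (\<mu> s) (g n s * r)) has_real_derivative 0) (at t)"
      by (rule DERIV_interval_cong[OF DERIV_const[of "coeff r (n - 1)"] t])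
         (use ortho_pair_fg[OF n] ortho_pair.orth_g r in blast)
    ultimately have "mfun (\<mu>' t) (g n t * r) + mfun (\<mu> t) (gd * r) = 0"
      by (rule DERIV_unique)
    moreover have "mfun (\<mu>t t) (g n t * r) = - mfun (\<mu>' t) (g n t * r)"
      unfolding \<mu>t_def[abs_def] by (rule mfun_uminus_moments)
    moreover have "mfun (\<mu>t t) (g n t * r) = poly r t * mfun (\<mu>t t) (g n t)"
      using node_split[of "\<mu>t t" t \<gamma>, OF node_t[OF t], of "g n t" r]
        orth_g[of "synthetic_div r t"] coeff_synthetic_div_top[of n r t] r n
      by (simp add: degree_synthetic_div coeff_eq_0)
    ultimately show ?thesis by simp
  qed
  with gd(1) deg show ?thesis by blast
qed

section \<open>Residue entries and their Schlesinger equations\<close>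

definition a :: "(real \<Rightarrow> nat \<Rightarrow> real) \<Rightarrow> nat \<Rightarrow> real \<Rightarrow> real" where
  "a \<nu> n s = mfun (\<nu> s) (f n s * g n s)"

definition b :: "(real \<Rightarrow> nat \<Rightarrow> real) \<Rightarrow> nat \<Rightarrow> real \<Rightarrow> real" where
  "b \<nu> n s = mfun (\<nu> s) (f n s * f n s)"

definition c :: "(real \<Rightarrow> nat \<Rightarrow> real) \<Rightarrow> nat \<Rightarrow> real \<Rightarrow> real" where
  "c \<nu> n s = mfun (\<nu> s) (g n s * g n s)"

context
  fixes n :: nat and t :: real
  assumes n: "n \<ge> 1" and t: "t \<in> {0<..<1}"
begin

interpretation ortho_pair "\<mu> t" n "f n t" "g n t"
  by (rule ortho_pair_fg[OF n t])

lemma bc_0: "b \<mu>0 n t * c \<mu>0 n t = a \<mu>0 n t * (a \<mu>0 n t - \<alpha>)"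
  unfolding a_def b_def c_def by (rule node_product[OF node_0[OF t]])

lemma bc_1: "b \<mu>1 n t * c \<mu>1 n t = a \<mu>1 n t * (a \<mu>1 n t - \<beta>)"
  unfolding a_def b_def c_def by (rule node_product[OF node_1[OF t]])

lemma bc_t: "b \<mu>t n t * c \<mu>t n t = a \<mu>t n t * (a \<mu>t n t - \<gamma>)"
  unfolding a_def b_def c_def by (rule node_product[OF node_t[OF t]])

lemma sum_b: "b \<mu>0 n t + b \<mu>1 n t + b \<mu>t n t = 0"
  unfolding b_def parts by (simp add: deriv_ff)

lemma sum_c: "c \<mu>0 n t + c \<mu>1 n t + c \<mu>t n t = 0"
  unfolding c_def parts by (simp add: deriv_gg)

lemma sum_a: "a \<mu>0 n t + a \<mu>1 n t + a \<mu>t n t = - real n"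
  unfolding a_def parts by (simp add: deriv_fg)

text \<open>Integrate \<open>x f g\<close> by parts. Since \<open>f g\<close> has regular integral
  zero, multiplication by \<open>x\<close> acts on each node functional as multiplication by the
  node, so node 0 drops out.\<close>

lemma p_eq: "p n t = a \<mu>1 n t + t * a \<mu>t n t"
proof -
  have x: "mfun mn ([:0, 1:] * (f n t * g n t)) = \<nu> * mfun mn (f n t * g n t)"
    if "\<And>k. mn (Suc k) - \<nu> * mn k = e * \<mu> t k" for mn \<nu> e
  proof -
    have "[:0, 1:] * (f n t * g n t) = [:-\<nu>, 1:] * (f n t * g n t) + Polynomial.smult \<nu> (f n t * g n t)"
      by simp
    then show ?thesis
      by (simp only: mfun_add mfun_smult mfun_linear_mult[of mn \<nu> e "\<mu> t", OF that] orth_gf)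
  qed
  from parts[of t "[:0, 1:] * (f n t * g n t)"]
  show ?thesis
    unfolding x[OF node_0[OF t]] x[OF node_1[OF t]] x[OF node_t[OF t]] deriv_xfg p_def a_def
    by simp
qed

lemma nonzero: "q \<noteq> 0 \<Longrightarrow> mfun (\<mu> t) (q * q) \<noteq> 0"
  using definite[OF t, of q] by simp

text \<open>Pairing \<open>fd\<close> with \<open>g\<close> reads off the derivative of
  \<open>p\<close>; by the kernel property the same pairing is \<open>g(t)\<close> times
  \<open>mfun (\<mu>t t) (f n t)\<close>, which is \<open>a \<mu>t n t\<close>.\<close>

lemma DERIV_p: "(p n has_real_derivative a \<mu>t n t) (at t)"
proof -
  obtain fd where fd: "coeffs_deriv (f n) fd t" "degree fd < n"
    "\<And>r. degree r < n \<Longrightarrow> mfun (\<mu> t) (fd * r) = poly r t * mfun (\<mu>t t) (f n t)"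
    using coeffs_deriv_f[OF n t] by blast
  have "coeff fd (n - 1) = a \<mu>t n t"
    unfolding a_def
    using orth_g[OF fd(2)] fd(3)[OF deg_g] node_fg[OF node_t[OF t]] by (simp add: mult.commute)
  then show ?thesis
    using fd(1) unfolding coeffs_deriv_def p_def[abs_def] by metis
qed

text \<open>The moments, \<open>f\<close> and \<open>g\<close> contribute the facts
  \<open>1\<close>, \<open>2\<close> and \<open>3\<close>. The rank-one factorizations
  \<open>nodes\<close> at \<open>t\<close> turn the products into residue entries; all terms with
  \<open>\<beta>\<close> or \<open>\<gamma>\<close> cancel and the commutator entry remains.\<close>

lemma DERIV_a1:
  "(a \<mu>1 n has_real_derivative (c \<mu>t n t * b \<mu>1 n t - b \<mu>t n t * c \<mu>1 n t) / (1 - t)) (at t)"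
proof -
  obtain fd where fd: "coeffs_deriv (f n) fd t" "degree fd < n"
    "\<And>r. degree r < n \<Longrightarrow> mfun (\<mu> t) (fd * r) = poly r t * mfun (\<mu>t t) (f n t)"
    using coeffs_deriv_f[OF n t] by blast
  obtain gd where gd: "coeffs_deriv (g n) gd t" "degree gd < n"
    "\<And>r. degree r < n \<Longrightarrow> mfun (\<mu> t) (gd * r) = poly r t * mfun (\<mu>t t) (g n t)"
    using coeffs_deriv_g[OF n t] by blast
  let ?F = "mfun (\<mu>t t) (f n t)" and ?G = "mfun (\<mu>t t) (g n t)"
  let ?ft = "poly (f n t) t" and ?gt = "poly (g n t) t"
  let ?m' = "\<lambda>k. (\<beta> * \<mu>t t k - \<gamma> * \<mu>1 t k) / (1 - t)"
  have deg: "degree (f n s * g n s) \<le> n + n" for s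
    using degree_mult_le[of "f n s" "g n s"] degree_f_le[of n s] degree_g_le[of n s] by linarith
  have "degree (fd * g n t) \<le> n + n" "degree (f n t * gd) \<le> n + n"
    using degree_mult_le[of "fd" "g n t"] degree_mult_le[of "f n t" gd]
      degree_f_le[of n t] degree_g_le[of n t] fd(2) gd(2) by linarith+
  then have deg': "degree (fd * g n t + f n t * gd) \<le> n + n"
    by (rule degree_add_le)
  have *: "(a \<mu>1 n has_real_derivative
      mfun ?m' (f n t * g n t) + mfun (\<mu>1 t) (fd * g n t + f n t * gd)) (at t)"
    unfolding a_def[abs_def]
    by (rule DERIV_mfun[OF deg deg' DERIV_\<mu>1[OF t] coeffs_deriv_mult[OF fd(1) gd(1)]])
  have "mfun ?m' (f n t * g n t) = mfun (\<lambda>k. 1 / (1 - t) * (\<beta> * \<mu>t t k - \<gamma> * \<mu>1 t k)) (f n t * g n t)"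
    by simp
  also have "\<dots> = (\<beta> * a \<mu>t n t - \<gamma> * a \<mu>1 n t) / (1 - t)"
    by (simp only: mfun_cmult mfun_minus_moments a_def) simp
  finally have 1: "(1 - t) * mfun ?m' (f n t * g n t) = \<beta> * a \<mu>t n t - \<gamma> * a \<mu>1 n t"
    using t by simp
  have L: "mfun (\<mu> t) (fd * g n t) = a \<mu>t n t"
    using fd(3)[OF deg_g] node_fg[OF node_t[OF t]] by (simp add: a_def)
  have L0: "mfun (\<mu> t) (gd * f n t) = 0"
    using orth_f[OF gd(2)] by (simp add: mult.commute)
  have 2: "(1 - t) * mfun (\<mu>1 t) (fd * g n t) =
      ?F * (?gt * a \<mu>1 n t - ?ft * c \<mu>1 n t) - \<beta> * a \<mu>t n t"
    using node_kernel[OF node_1[OF t] nonzero fd(2,3), of "g n t"]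
    by (simp add: L a_def c_def)
  have 3: "(1 - t) * mfun (\<mu>1 t) (gd * f n t) =
      ?G * (?gt * b \<mu>1 n t - ?ft * a \<mu>1 n t)"
    using node_kernel[OF node_1[OF t] nonzero gd(2,3), of "f n t"]
    by (simp add: L0 a_def b_def mult.commute[of "g n t"])
  have nodes: "?gt * ?F = a \<mu>t n t" "?ft * ?F = b \<mu>t n t" "?gt * ?G = c \<mu>t n t"
      "?ft * ?G = a \<mu>t n t - \<gamma>"
    unfolding a_def b_def c_def
    by (rule node_fg[OF node_t[OF t]] node_ff[OF node_t[OF t]] node_gg[OF node_t[OF t]]
        node_gf[OF node_t[OF t]])+
  have "(1 - t) * (mfun ?m' (f n t * g n t) + mfun (\<mu>1 t) (fd * g n t + f n t * gd)) =
      \<beta> * a \<mu>t n t - \<gamma> * a \<mu>1 n t + (?F * (?gt * a \<mu>1 n t - ?ft * c \<mu>1 n t) - \<beta> * a \<mu>t n t)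
      + ?G * (?gt * b \<mu>1 n t - ?ft * a \<mu>1 n t)"
    by (simp only: mfun_add distrib_left 1 2 3 mult.commute[of "f n t" gd])
  also have "\<dots> = (?gt * ?F) * a \<mu>1 n t - (?ft * ?F) * c \<mu>1 n t + (?gt * ?G) * b \<mu>1 n t
      - (?ft * ?G) * a \<mu>1 n t - \<gamma> * a \<mu>1 n t"
    by (simp add: algebra_simps)
  also have "\<dots> = c \<mu>t n t * b \<mu>1 n t - b \<mu>t n t * c \<mu>1 n t"
    unfolding nodes by (simp add: algebra_simps)
  finally have "mfun ?m' (f n t * g n t) + mfun (\<mu>1 t) (fd * g n t + f n t * gd) =
      (c \<mu>t n t * b \<mu>1 n t - b \<mu>t n t * c \<mu>1 n t) / (1 - t)"
    using t by (simp add: field_simps)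
  with * show ?thesis by simp
qed

text \<open>The derivative of \<open>f\<close> has degree below \<open>n\<close> and is orthogonal
  to \<open>f\<close>, so only the moments contribute.\<close>

lemma DERIV_ff:
  "((\<lambda>s. mfun (\<mu> s) (f n s * f n s)) has_real_derivative - b \<mu>t n t) (at t)"
proof -
  obtain fd where fd: "coeffs_deriv (f n) fd t" "degree fd < n"
    using coeffs_deriv_f[OF n t] by blast
  have deg: "degree (f n s * f n s) \<le> n + n" for s
    using degree_mult_le[of "f n s" "f n s"] degree_f_le[of n s] by linarith
  have "degree (fd * f n t) \<le> n + n" "degree (f n t * fd) \<le> n + n"
    using degree_mult_le[of fd "f n t"] degree_mult_le[of "f n t" fd] degree_f_le[of n t] fd(2)
    by linarith+
  then have deg': "degree (fd * f n t + f n t * fd) \<le> n + n"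
    by (rule degree_add_le)
  have "((\<lambda>s. mfun (\<mu> s) (f n s * f n s)) has_real_derivative
      mfun (\<mu>' t) (f n t * f n t) + mfun (\<mu> t) (fd * f n t + f n t * fd)) (at t)"
    by (rule DERIV_mfun[OF deg deg' der[OF t] coeffs_deriv_mult[OF fd(1) fd(1)]])
  moreover have "mfun (\<mu> t) (fd * f n t + f n t * fd) = 0"
    using orth_f[OF fd(2)] by (simp only: mfun_add mult.commute[of fd])
  moreover have "mfun (\<mu>' t) (f n t * f n t) = - b \<mu>t n t"
    unfolding b_def \<mu>t_def[abs_def] by (simp add: mfun_uminus_moments)
  ultimately show ?thesis by simp
qed

text \<open>Integrate \<open>x (x - 1) f f\<close> by parts. The factor reduces nodes 0 and 1 to
  regular integrals and leaves \<open>b \<mu>t n t\<close> with coefficient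
  \<open>t (t - 1)\<close>.\<close>

lemma bt_eq:
  assumes h: "h = mfun (\<mu> t) (f n t * f n t)" and "\<delta> = p n t - p (Suc n) t"
  shows "t * (t - 1) * b \<mu>t n t =
    ((1 + 2 * real n + \<alpha> + \<gamma> * (1 - t)) - (2 * real n + 2 + \<alpha> + \<beta> + \<gamma>) * \<delta> + 2 * p n t) * h"
proof -
  interpret S: ortho_pair "\<mu> t" "Suc n" "f (Suc n) t" "g (Suc n) t"
    using ortho_pair_fg[OF _ t, of "Suc n"] by simp
  let ?q = "f n t * f n t"
  \<comment> \<open>\<open>\<delta>\<close> is the diagonal coefficient of the three-term
    recurrence: \<open>x f_n - f_(n+1)\<close> has coefficient \<open>\<delta>\<close> in degree
    \<open>n\<close>.\<close>
  have x: "mfun (\<mu> t) ([:0, 1:] * ?q) = \<delta> * h"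
  proof -
    define r where "r = [:0, 1:] * f n t - f (Suc n) t"
    have "degree ([:0, 1:] * f n t) \<le> Suc n"
      using degree_mult_le[of "[:0, 1:]" "f n t"] deg_f by simp
    then have "degree r \<le> Suc n"
      unfolding r_def using S.deg_f by (intro degree_diff_le) auto
    moreover have "coeff r (Suc n) = 0"
      by (simp add: r_def lead_f S.lead_f)
    ultimately have "degree r \<le> n"
      using degree_less_if_coeff_0[of "Suc n" r] by simp
    moreover have "coeff r n = \<delta>"
      using n by (cases n) (auto simp: r_def assms p_def)
    ultimately have "mfun (\<mu> t) (f n t * r) = \<delta> * h"
      by (simp add: orth_f_top h)
    moreover have "mfun (\<mu> t) (f (Suc n) t * f n t) = 0"
      using S.orth_f[of "f n t"] deg_f by simp
    moreover have "[:0, 1:] * ?q = f n t * r + f (Suc n) t * f n t"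
      by (simp add: r_def algebra_simps)
    ultimately show ?thesis by (simp only: mfun_add)
  qed
  have lin: "mfun (\<mu> t) ([:u, v:] * ?q) = (u + v * \<delta>) * h" for u v
  proof -
    have "[:u, v:] * ?q = Polynomial.smult u ?q + Polynomial.smult v ([:0, 1:] * ?q)"
      by simp
    then show ?thesis
      by (simp only: mfun_add mfun_smult x h[symmetric]) (simp add: algebra_simps)
  qed
  have "mfun (\<mu>0 t) ([:0, -1, 1:] * ?q) = \<alpha> * ((-1 + \<delta>) * h)"
  proof -
    have "[:0, -1, 1:] * ?q = [:-0, 1:] * ([:-1, 1:] * ?q)" by (simp add: algebra_simps)
    then show ?thesis
      by (simp only: mfun_linear_mult[of "\<mu>0 t" 0 \<alpha> "\<mu> t", OF node_0[OF t]] lin) simp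
  qed
  moreover have "mfun (\<mu>1 t) ([:0, -1, 1:] * ?q) = \<beta> * (\<delta> * h)"
  proof -
    have "[:0, -1, 1:] * ?q = [:-1, 1:] * ([:0, 1:] * ?q)" by (simp add: algebra_simps)
    then show ?thesis
      by (simp only: mfun_linear_mult[of "\<mu>1 t" 1 \<beta> "\<mu> t", OF node_1[OF t]] lin) simp
  qed
  moreover have "mfun (\<mu>t t) ([:0, -1, 1:] * ?q) = \<gamma> * ((t - 1 + \<delta>) * h) + t * (t - 1) * b \<mu>t n t"
  proof -
    \<comment> \<open>Division of \<open>x (x - 1)\<close> by \<open>x - t\<close>, with remainder
      \<open>t (t - 1)\<close>.\<close>
    have "[:0, -1, 1:] = [:-t, 1:] * [:t - 1, 1:] + [:t * (t - 1):]" by (simp add: algebra_simps)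
    then have "[:0, -1, 1:] * ?q = ([:-t, 1:] * [:t - 1, 1:] + [:t * (t - 1):]) * ?q" by (simp only:)
    also have "\<dots> = [:-t, 1:] * ([:t - 1, 1:] * ?q) + Polynomial.smult (t * (t - 1)) ?q"
      by (simp only: distrib_right mult.assoc) simp
    finally show ?thesis
      by (simp only: mfun_add mfun_smult mfun_linear_mult[of "\<mu>t t" t \<gamma> "\<mu> t", OF node_t[OF t]] lin b_def)
         simp
  qed
  moreover have "mfun (\<mu> t) (pderiv ([:0, -1, 1:] * ?q)) =
      (-1 + 2 * \<delta>) * h + 2 * (n * (\<delta> * h) - (n + p n t) * h)"
  proof -
    have "pderiv [:0, -1, 1::real:] = [:-1, 2:]" by (simp add: pderiv_pCons)
    moreover have "Polynomial.smult 2 u = u + u" for u :: "real poly"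
      using smult_add_left[of 1 1 u] by simp
    ultimately have "pderiv ([:0, -1, 1:] * ?q) =
        [:-1, 2:] * ?q + Polynomial.smult 2 (f n t * ([:0, -1, 1:] * pderiv (f n t)))"
      by (simp only: pderiv_mult algebra_simps)
    then show ?thesis
      by (simp only: mfun_add mfun_smult lin mfun_x_pderiv_ff p_def h[symmetric]) simp
  qed
  ultimately show ?thesis
    using parts[of t "[:0, -1, 1:] * ?q"] by (simp add: algebra_simps)
qed

end

text \<open>Solve \<open>p_eq\<close> for \<open>a \<mu>t\<close> and differentiate; since the
  derivative of \<open>p\<close> is \<open>a \<mu>t\<close> itself, the undifferentiated terms
  cancel.\<close>

lemma DERIV_a_t:
  assumes n: "n \<ge> 1" and t: "t \<in> {0<..<1}"
  shows "(a \<mu>t n has_real_derivative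
    - (c \<mu>t n t * b \<mu>1 n t - b \<mu>t n t * c \<mu>1 n t) / (t * (1 - t))) (at t)"
proof (rule DERIV_interval_cong[OF _ t])
  show "a \<mu>t n s = (p n s - a \<mu>1 n s) / s" if "s \<in> {0<..<1}" for s
    using that p_eq[OF n that] by simp
  let ?E = "c \<mu>t n t * b \<mu>1 n t - b \<mu>t n t * c \<mu>1 n t"
  have "((\<lambda>s. (p n s - a \<mu>1 n s) / s) has_real_derivative
    ((a \<mu>t n t - ?E / (1 - t)) * t - (p n t - a \<mu>1 n t) * 1) / (t * t)) (at t)"
    using t by (intro derivative_intros DERIV_p DERIV_a1 n) auto
  moreover have "((a \<mu>t n t - ?E / (1 - t)) * t - (p n t - a \<mu>1 n t) * 1) / (t * t) =
      - ?E / (t * (1 - t))"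
    using t p_eq[OF n t] by (simp add: field_simps)
  ultimately show "((\<lambda>s. (p n s - a \<mu>1 n s) / s) has_real_derivative
      - ?E / (t * (1 - t))) (at t)"
    by simp
qed

end

section \<open>The sigma form\<close>

text \<open>
  The combinations \<open>h1 = H'\<close> and \<open>W = t H' - H\<close> make the identity free of \<open>t\<close>.  After multiplication
  by \<open>k\<^sup>2\<close> both sides are polynomials in \<open>h1\<close> and \<open>W\<close>, compared coefficientwise.
\<close>

lemma gram_determinant_reduced:
  fixes x y z n k h1 W K m c2 cc1 \<alpha> \<beta> \<gamma> :: real
  assumes z: "z = - n - y - x" and k: "k = 2 * n + \<alpha> + \<beta> + \<gamma>" "k \<noteq> 0"
   and h1: "h1 = n * \<gamma> - k * x" and W: "W = n * (n+\<alpha>+\<gamma>) + k*y"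
    and c2: "c2 = 4 * n^2 + 4 * n * (\<alpha> + \<beta> + \<gamma>) + (\<alpha> + \<beta>)^2"
    and c1: "cc1 = 2 * n^2 + 2 * n * (\<alpha> + \<beta> + \<gamma>) + \<alpha> * (\<alpha> + \<gamma>) + \<beta> * (\<alpha> - \<gamma>)"
    and m: "m = n + \<alpha> + \<beta> + \<gamma>" and K: "K = n * \<gamma> * m"
  shows "k^2 * ((z * (z - \<alpha>) - y * (y - \<beta>) - x * (x - \<gamma>))^2 - 4 * (y * (y - \<beta>)) * (x * (x - \<gamma>)))
    + 4*h1*W*(W-h1) - c2*W^2 + 2*cc1*h1*W - (\<alpha> + \<gamma>)^2*h1^2 + 2*K*(\<alpha>+\<gamma>)*h1 - 2*K*(\<alpha>-\<beta>)*W - K^2 = 0"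
    (is "k^2 * ((?R - ?Q - ?P)^2 - 4 * _ * _) + _ - _ + _ - _ + _ - _ - _ = 0")
proof -
  \<comment> \<open>Coefficients of \<open>k^2 x (x - \<gamma>)\<close> as a quadratic in
    \<open>h1\<close> and of \<open>k^2 y (y - \<beta>)\<close> as a quadratic in
    \<open>W\<close>.\<close>
  define p1 p0 q1 q0 where "p1 = \<gamma> * (\<alpha> + \<beta> + \<gamma>)" and "p0 = - \<gamma> * K"
    and "q1 = - (n * (n + \<alpha> + \<gamma>) + (n + \<beta>) * m)" and "q0 = n * (n + \<alpha> + \<gamma>) * (n + \<beta>) * m"
  note defs = p1_def p0_def q1_def q0_def K m k(1)
  have kx: "k * x = n * \<gamma> - h1" and ky: "k * y = W - n * (n + \<alpha> + \<gamma>)"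
    using h1 W by simp_all
  have kz: "k * z = h1 - W - n * (n + \<beta> + \<gamma>)"
  proof -
    have "k * z = - (n * k) - k * y - k * x" unfolding z by (simp add: algebra_simps)
    then show ?thesis unfolding kx ky by (simp add: k algebra_simps)
  qed
  have P: "k^2 * ?P = h1^2 + p1 * h1 + p0"
  proof -
    have "k^2 * ?P = (k * x) * (k * x - k * \<gamma>)" by (simp add: power2_eq_square algebra_simps)
    then show ?thesis unfolding kx by (simp add: defs power2_eq_square algebra_simps)
  qed
  have Q: "k^2 * ?Q = W^2 + q1 * W + q0"
  proof -
    have "k^2 * ?Q = (k * y) * (k * y - k * \<beta>)" by (simp add: power2_eq_square algebra_simps)
    then show ?thesis unfolding ky by (simp add: defs power2_eq_square algebra_simps)
  qed
  have S: "k^2 * (?R - ?Q - ?P) = - 2 * h1 * W - (k^2 + q1) * h1 + (k^2 - p1) * W + K * (\<alpha> - \<beta> + \<gamma>)"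
  proof -
    have "k^2 * ?R = (k * z) * (k * z - k * \<alpha>)" by (simp add: power2_eq_square algebra_simps)
    then have "k^2 * (?R - ?Q - ?P) = (k * z) * (k * z - k * \<alpha>) - (W^2 + q1 * W + q0) - (h1^2 + p1 * h1 + p0)"
      by (simp only: right_diff_distrib[of "k^2" "?R - ?Q" ?P] right_diff_distrib[of "k^2" ?R ?Q] P Q)
    then show ?thesis unfolding kz by (simp add: defs power2_eq_square algebra_simps)
  qed
  let ?E2 = "k^2 * ((?R - ?Q - ?P)^2 - 4 * ?Q * ?P)"
  have "k^2 * (k^2 * ((?R - ?Q - ?P)^2 - 4 * ?Q * ?P)) =
      (k^2 * (?R - ?Q - ?P))^2 - 4 * (k^2 * ?Q) * (k^2 * ?P)"
    by (simp add: power2_eq_square algebra_simps)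
  also have "\<dots> = (- 2 * h1 * W - (k^2 + q1) * h1 + (k^2 - p1) * W + K * (\<alpha> - \<beta> + \<gamma>))^2
      - 4 * (W^2 + q1 * W + q0) * (h1^2 + p1 * h1 + p0)"
    unfolding S P Q ..
  \<comment> \<open>The terms in \<open>h1^2 W^2\<close> cancel. Each remaining coefficient is then
    shown to be a multiple of \<open>k^2\<close>, which is finally divided out.\<close>
  also have "\<dots> = - 4 * k^2 * h1 * W * (W - h1) + ((k^2 - p1)^2 - 4 * p0) * W^2
      + (- 4 * K * (\<alpha> - \<beta> + \<gamma>) - 2 * (k^2 + q1) * (k^2 - p1) - 4 * p1 * q1) * h1 * W
      + ((k^2 + q1)^2 - 4 * q0) * h1^2
      + (- 2 * (k^2 + q1) * (K * (\<alpha> - \<beta> + \<gamma>)) - 4 * p1 * q0) * h1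
      + (2 * (k^2 - p1) * (K * (\<alpha> - \<beta> + \<gamma>)) - 4 * p0 * q1) * W
      + ((K * (\<alpha> - \<beta> + \<gamma>))^2 - 4 * p0 * q0)"
    by (simp add: power2_eq_square algebra_simps)
  also have "(k^2 - p1)^2 - 4 * p0 = k^2 * c2"
    by (simp add: defs c2 power2_eq_square algebra_simps)
  also have "- 4 * K * (\<alpha> - \<beta> + \<gamma>) - 2 * (k^2 + q1) * (k^2 - p1) - 4 * p1 * q1 = - 2 * k^2 * cc1"
    by (simp add: defs c1 power2_eq_square algebra_simps)
  also have "(k^2 + q1)^2 - 4 * q0 = k^2 * (\<alpha> + \<gamma>)^2"
    by (simp add: defs power2_eq_square algebra_simps)
  also have "- 2 * (k^2 + q1) * (K * (\<alpha> - \<beta> + \<gamma>)) - 4 * p1 * q0 = - 2 * k^2 * K * (\<alpha> + \<gamma>)"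
    by (simp add: defs power2_eq_square algebra_simps)
  also have "2 * (k^2 - p1) * (K * (\<alpha> - \<beta> + \<gamma>)) - 4 * p0 * q1 = 2 * k^2 * K * (\<alpha> - \<beta>)"
    by (simp add: defs power2_eq_square algebra_simps)
  also have "(K * (\<alpha> - \<beta> + \<gamma>))^2 - 4 * p0 * q0 = k^2 * K^2"
  proof -
    have "p0 * q0 = - K * (K * ((n + \<alpha> + \<gamma>) * (n + \<beta>)))"
      by (simp add: p0_def q0_def K)
    then have "(K * (\<alpha> - \<beta> + \<gamma>))^2 - 4 * p0 * q0 =
        K^2 * ((\<alpha> - \<beta> + \<gamma>)^2 + 4 * ((n + \<alpha> + \<gamma>) * (n + \<beta>)))"
      by (simp add: power2_eq_square algebra_simps)
    also have "(\<alpha> - \<beta> + \<gamma>)^2 + 4 * ((n + \<alpha> + \<gamma>) * (n + \<beta>)) = k^2"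
      by (simp add: k power2_eq_square algebra_simps)
    finally show ?thesis by simp
  qed
  finally have "k^2 * ?E2 = - 4 * k^2 * h1 * W * (W - h1) + k^2 * c2 * W^2 + - 2 * k^2 * cc1 * h1 * W
      + k^2 * (\<alpha> + \<gamma>)^2 * h1^2 + - 2 * k^2 * K * (\<alpha> + \<gamma>) * h1 + 2 * k^2 * K * (\<alpha> - \<beta>) * W
      + k^2 * K^2" .
  then have "k^2 * (?E2 + 4*h1*W*(W-h1) - c2*W^2 + 2*cc1*h1*W - (\<alpha> + \<gamma>)^2*h1^2
      + 2*K*(\<alpha>+\<gamma>)*h1 - 2*K*(\<alpha>-\<beta>)*W - K^2) = 0"
    by (simp add: algebra_simps)
  then show ?thesis using k(2) by simp
qed

text \<open>\<open>E^2\<close> is the square of \<open>ct b1 + bt c1\<close> minus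
  \<open>4 b1 c1 bt ct\<close>. The vanishing sums turn that bracket into
  \<open>b0 c0 - b1 c1 - bt ct\<close>, so only the known products occur. Substituting
  \<open>h = t h1 - W\<close> removes \<open>t\<close>.\<close>

lemma gram_identity:
  fixes \<alpha> \<beta> \<gamma> t n x y b0 b1 bt c0 c1 ct z :: real
  assumes "b0 * c0 = z * (z - \<alpha>)" "b1 * c1 = y * (y - \<beta>)" "bt * ct = x * (x - \<gamma>)"
    and "b0 + b1 + bt = 0" "c0 + c1 + ct = 0" "z + y + x = - n"
    and "h = - n * (n + \<alpha> + \<gamma> * (1 - t)) - (2 * n + \<alpha> + \<beta> + \<gamma>) * (y + t * x)"
    and "h1 = n * \<gamma> - (2 * n + \<alpha> + \<beta> + \<gamma>) * x"
    and "E = ct * b1 - bt * c1"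
    and c2: "c2 = 4 * n^2 + 4 * n * (\<alpha> + \<beta> + \<gamma>) + (\<alpha> + \<beta>)^2"
    and c1': "cc1 = 2 * n^2 + 2 * n * (\<alpha> + \<beta> + \<gamma>) + \<alpha> * (\<alpha> + \<gamma>) + \<beta> * (\<alpha> - \<gamma>)"
    and m: "m = n + \<alpha> + \<beta> + \<gamma>"
    and nz: "2 * n + \<alpha> + \<beta> + \<gamma> \<noteq> 0"
  shows "((2 * n + \<alpha> + \<beta> + \<gamma>) * E)^2 + 4 * t * (t - 1) * h1^3
        - (4 * (2 * t - 1) * h + c2 * t^2 - 2 * cc1 * t + (\<alpha> + \<gamma>)^2) * h1^2
        + 2 * (2 * h^2 + (c2 * t - cc1) * h
               - n * \<gamma> * m * ((\<alpha> - \<beta>) * t - \<alpha> - \<gamma>)) * h1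
        - c2 * h^2
        + 2 * n * \<gamma> * (\<alpha> - \<beta>) * m * h
        - n^2 * \<gamma>^2 * m^2 = 0"
proof -
  define S where "S = z * (z - \<alpha>) - y * (y - \<beta>) - x * (x - \<gamma>)"
  have b0: "b0 = - b1 - bt" and c0: "c0 = - c1 - ct" and z: "z = - n - y - x"
    using assms by linarith+
  have "ct * b1 + bt * c1 = b0 * c0 - b1 * c1 - bt * ct"
    unfolding b0 c0 by (simp add: algebra_simps)
  then have S: "ct * b1 + bt * c1 = S" using assms by (simp add: S_def)
  have "E^2 = (ct * b1 + bt * c1)^2 - 4 * (b1 * c1) * (bt * ct)"
    unfolding assms(9) by (simp add: power2_eq_square algebra_simps)
  also have "\<dots> = S^2 - 4 * (y * (y - \<beta>)) * (x * (x - \<gamma>))"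
    unfolding S assms(2,3) ..
  finally have E: "E^2 = S^2 - 4 * (y * (y - \<beta>)) * (x * (x - \<gamma>))" .
  define K W where "K = n * \<gamma> * m"
    and "W = n * (n + \<alpha> + \<gamma>) + (2 * n + \<alpha> + \<beta> + \<gamma>) * y"
  have h: "h = t * h1 - W"
    unfolding assms(7,8) W_def by (simp add: algebra_simps)
  let ?E2 = "(2 * n + \<alpha> + \<beta> + \<gamma>)^2 * (S^2 - 4 * (y * (y - \<beta>)) * (x * (x - \<gamma>)))"
  have "?E2 + 4 * t * (t - 1) * h1^3
        - (4 * (2 * t - 1) * h + c2 * t^2 - 2 * cc1 * t + (\<alpha> + \<gamma>)^2) * h1^2
        + 2 * (2 * h^2 + (c2 * t - cc1) * h
               - K * ((\<alpha> - \<beta>) * t - \<alpha> - \<gamma>)) * h1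
        - c2 * h^2 + 2 * K * (\<alpha> - \<beta>) * h - K^2 =
      ?E2 + 4 * h1 * W * (W - h1) - c2 * W^2 + 2 * cc1 * h1 * W - (\<alpha> + \<gamma>)^2 * h1^2
        + 2 * K * (\<alpha> + \<gamma>) * h1 - 2 * K * (\<alpha> - \<beta>) * W - K^2"
    unfolding h by (simp add: algebra_simps power2_eq_square power3_eq_cube)
  also have "\<dots> = 0"
    unfolding S_def
    by (rule gram_determinant_reduced[OF z refl nz assms(8) W_def c2 c1' m K_def])
  finally show ?thesis
    unfolding power_mult_distrib E K_def by (simp add: power_mult_distrib mult_ac)
qed


section \<open>Logarithmic derivative of the Hankel determinant\<close>

context jacobi_moments
begin

lemma D_1: "D 1 s = \<mu> s 0"
  by (simp add: D_def hank_def det_single)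

text \<open>Induction through \<open>ln D_(n+1) = ln D_n + ln h_n\<close> with \<open>h_n\<close>
  the squared norm of \<open>f\<close>, whose logarithmic derivative
  \<open>- b \<mu>t n t / h\<close> is given by \<open>bt_eq\<close>. The base case is
  \<open>gauss\<close> at \<open>k = 0\<close>.\<close>

lemma DERIV_ln_D:
  assumes "n \<ge> 1" and t: "t \<in> {0<..<1}"
  shows "((\<lambda>s. ln (D n s)) has_real_derivative
    (- real n * (n + \<alpha> + \<gamma> * (1 - t)) - (2 * real n + \<alpha> + \<beta> + \<gamma>) * p n t) / (t * (t - 1))) (at t)"
  using assms(1)
proof (induction n rule: nat_induct_at_least)
  case base
  interpret ortho_pair "\<mu> t" 1 "f 1 t" "g 1 t" by (rule ortho_pair_fg[OF _ t]) simp
  have pos: "\<mu> t 0 > 0" using D_pos[OF t, of 1] by (simp only: D_1)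
  have "((\<lambda>s. ln (D 1 s)) has_real_derivative \<mu>' t 0 / \<mu> t 0) (at t)"
    unfolding D_1 using pos by (auto intro!: derivative_eq_intros der t simp: field_simps)
  \<comment> \<open>\<open>f 1 t\<close> is \<open>x + p 1 t\<close>; orthogonality to 1 expresses
    the first moment through the zeroth.\<close>
  moreover have "p 1 t * \<mu> t 0 = - \<mu> t 1"
    using orth_f[of 1] lead_f deg_f
    by (simp add: p_def mfun_def)
  then have "\<mu> t 1 = - p 1 t * \<mu> t 0" by simp
  then have "t * (1 - t) * \<mu>' t 0 =
      (1 + \<alpha> + \<gamma> * (1 - t) + (2 + \<alpha> + \<beta> + \<gamma>) * p 1 t) * \<mu> t 0"
    using gauss[OF t, of 0] by (simp add: algebra_simps)
  then have "\<mu>' t 0 / \<mu> t 0 =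
      (- real 1 * (real 1 + \<alpha> + \<gamma> * (1 - t)) - (2 * real 1 + \<alpha> + \<beta> + \<gamma>) * p 1 t) / (t * (t - 1))"
    using t pos by (simp add: divide_simps) (simp add: algebra_simps)
  ultimately show ?case by (simp only:)
next
  case (Suc n)
  have n: "n \<ge> 1" using Suc by simp
  define h where "h = mfun (\<mu> t) (f n t * f n t)"
  have h: "h > 0" unfolding h_def using mfun_ff[OF n t] D_pos[OF t] by simp
  define \<delta> where "\<delta> = p n t - p (Suc n) t"
  have "((\<lambda>s. ln (mfun (\<mu> s) (f n s * f n s))) has_real_derivative - b \<mu>t n t / h) (at t)"
    using h DERIV_ff[OF n t] unfolding h_def
    by (auto intro!: derivative_eq_intros simp: field_simps)
  from DERIV_add[OF Suc.IH this]
  have "((\<lambda>s. ln (D (Suc n) s)) has_real_derivative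
    (- real n * (n + \<alpha> + \<gamma> * (1 - t)) - (2 * real n + \<alpha> + \<beta> + \<gamma>) * p n t) / (t * (t - 1)) + - b \<mu>t n t / h) (at t)"
  proof (rule DERIV_interval_cong[OF _ t])
    fix s :: real assume s: "s \<in> {0<..<1}"
    show "ln (D (Suc n) s) = ln (D n s) + ln (mfun (\<mu> s) (f n s * f n s))"
      unfolding mfun_ff[OF n s] using D_pos[OF s, of n] D_pos[OF s, of "Suc n"]
      by (simp add: ln_div)
  qed
  moreover have "b \<mu>t n t / h = ((1 + 2 * real n + \<alpha> + \<gamma> * (1 - t))
      - (2 * real n + 2 + \<alpha> + \<beta> + \<gamma>) * \<delta> + 2 * p n t) / (t * (t - 1))"
    using bt_eq[OF n t h_def \<delta>_def] t h by (simp add: divide_simps) (simp add: algebra_simps)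
  moreover have "- real n * (n + \<alpha> + \<gamma> * (1 - t)) - (2 * real n + \<alpha> + \<beta> + \<gamma>) * p n t
      - ((1 + 2 * real n + \<alpha> + \<gamma> * (1 - t)) - (2 * real n + 2 + \<alpha> + \<beta> + \<gamma>) * \<delta> + 2 * p n t)
    = - real (Suc n) * (Suc n + \<alpha> + \<gamma> * (1 - t)) - (2 * real (Suc n) + \<alpha> + \<beta> + \<gamma>) * p (Suc n) t"
    unfolding \<delta>_def by (simp add: algebra_simps)
  ultimately show ?case
    by (simp only: minus_divide_left[symmetric] diff_conv_add_uminus[symmetric] diff_divide_distrib[symmetric])
qed

text \<open>The factor \<open>s (s - 1)\<close> cancels the denominator in
  \<open>DERIV_ln_D\<close>, so \<open>H\<close> is affine in \<open>p\<close>, and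
  \<open>p_eq\<close> and \<open>DERIV_a_t\<close> supply the data of \<open>gram_identity\<close>.
  \<open>nz\<close> allows the division by \<open>k^2\<close> there.\<close>

theorem sigma_form:
  assumes n: "n \<ge> 1" and t: "t \<in> {0<..<1}" and nz: "2 * real n + \<alpha> + \<beta> + \<gamma> \<noteq> 0"
    and H: "\<And>s. s \<in> {0<..<1} \<Longrightarrow> H s = s * (s - 1) * deriv (\<lambda>s. ln (D n s)) s"
  shows "(\<lambda>s. ln (D n s)) differentiable (at t) \<and> H differentiable (at t) \<and> deriv H differentiable (at t) \<and>
    (let h = H t; h1 = deriv H t; h2 = deriv (deriv H) t;
         c2 = 4 * n^2 + 4 * n * (\<alpha> + \<beta> + \<gamma>) + (\<alpha> + \<beta>)^2;
         c1 = 2 * n^2 + 2 * n * (\<alpha> + \<beta> + \<gamma>) + \<alpha> * (\<alpha> + \<gamma>) + \<beta> * (\<alpha> - \<gamma>);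
         m = n + \<alpha> + \<beta> + \<gamma>
     in t^2 * (t - 1)^2 * h2^2 + 4 * t * (t - 1) * h1^3
        - (4 * (2 * t - 1) * h + c2 * t^2 - 2 * c1 * t + (\<alpha> + \<gamma>)^2) * h1^2
        + 2 * (2 * h^2 + (c2 * t - c1) * h
               - n * \<gamma> * m * ((\<alpha> - \<beta>) * t - \<alpha> - \<gamma>)) * h1
        - c2 * h^2
        + 2 * n * \<gamma> * (\<alpha> - \<beta>) * m * h
        - n^2 * \<gamma>^2 * m^2 = 0)"
proof -
  let ?k = "2 * real n + \<alpha> + \<beta> + \<gamma>"
  let ?E = "c \<mu>t n t * b \<mu>1 n t - b \<mu>t n t * c \<mu>1 n t"
  have H0: "H s = - real n * (n + \<alpha> + \<gamma> * (1 - s)) - ?k * p n s" if "s \<in> {0<..<1}" for s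
    using that DERIV_imp_deriv[OF DERIV_ln_D[OF n that]] by (simp add: H)
  have DH: "(H has_real_derivative n * \<gamma> - ?k * a \<mu>t n s) (at s)" if s: "s \<in> {0<..<1}" for s
    by (rule DERIV_interval_cong[OF _ s H0])
       (auto intro!: derivative_eq_intros DERIV_p n s)
  then have H1: "deriv H s = n * \<gamma> - ?k * a \<mu>t n s" if "s \<in> {0<..<1}" for s
    using that DERIV_imp_deriv by blast
  have DDH: "(deriv H has_real_derivative 0 - ?k * (- ?E / (t * (1 - t)))) (at t)"
    by (rule DERIV_interval_cong[OF _ t H1])
       (intro DERIV_diff DERIV_const DERIV_cmult DERIV_a_t n t)
  have "t * (t - 1) * deriv (deriv H) t = - (?k * ?E)"
    using t unfolding DERIV_imp_deriv[OF DDH] by (simp add: divide_simps) (simp add: algebra_simps)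
  then have "t^2 * (t - 1)^2 * (deriv (deriv H) t)^2 = (?k * ?E)^2"
    by (metis power2_minus power_mult_distrib)
  then have H2: "t^2 * (t - 1)^2 * (deriv (deriv H) t)^2 = (?k * ?E)^2" .
  have "(\<lambda>s. ln (D n s)) differentiable (at t)" "H differentiable (at t)" "deriv H differentiable (at t)"
    using DERIV_ln_D[OF n t] DH[OF t] DDH real_differentiable_def by blast+
  then show ?thesis
    unfolding Let_def H2
    using gram_identity[OF bc_0[OF n t] bc_1[OF n t] bc_t[OF n t] sum_b[OF n t] sum_c[OF n t] sum_a[OF n t]
      H0[OF t, unfolded p_eq[OF n t]] H1[OF t] refl refl refl refl nz]
    by simp
qed

end

section \<open>Moments of the weight\<close>

text \<open>
  With \<open>p = \<alpha> + k\<close>, \<open>q = \<beta>\<close>, \<open>s = t\<close> this is the part of the \<open>k\<close>-th moment over \<open>[0, t]\<close>; the part over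
  \<open>[t, 1]\<close> becomes \<open>p = \<beta>\<close>, \<open>q = \<alpha> + k\<close>, \<open>s = 1 - t\<close> under \<open>x \<mapsto> 1 - x\<close>.
\<close>

definition jacobi_int :: "real \<Rightarrow> real \<Rightarrow> real \<Rightarrow> real \<Rightarrow> real" where
  "jacobi_int \<gamma> p q s = integral {0..s} (\<lambda>x. x powr p * (1 - x) powr q * (s - x) powr \<gamma>)"

section \<open>Contiguity relations and the derivative of \<open>jacobi_int\<close>\<close>

context
  fixes \<gamma> :: real
  assumes \<gamma>: "\<gamma> > 0"
begin

lemma jacobi_continuous:
  assumes "p > 0" "s < 1"
  shows "continuous_on {0..s} (\<lambda>x. x powr p * (1 - x) powr q * (s - x) powr \<gamma>)"
  using assms \<gamma> by (intro continuous_intros continuous_on_powr') auto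

lemma has_integral_jacobi:
  assumes "p > 0" "s < 1"
  shows "((\<lambda>x. x powr p * (1 - x) powr q * (s - x) powr \<gamma>) has_integral jacobi_int \<gamma> p q s) {0..s}"
  unfolding jacobi_int_def
  by (rule integrable_integral) (intro integrable_continuous_interval jacobi_continuous assms)

lemma jacobi_contiguous:
  assumes "p > 0" "s < 1"
  shows "jacobi_int \<gamma> p (q + 1) s = jacobi_int \<gamma> p q s - jacobi_int \<gamma> (p + 1) q s"
proof (rule has_integral_unique[OF has_integral_jacobi[OF assms]])
  have "((\<lambda>x. x powr p * (1 - x) powr q * (s - x) powr \<gamma> - x powr (p + 1) * (1 - x) powr q * (s - x) powr \<gamma>)
      has_integral jacobi_int \<gamma> p q s - jacobi_int \<gamma> (p + 1) q s) {0..s}"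
    by (intro has_integral_diff has_integral_jacobi) (use assms in auto)
  then show "((\<lambda>x. x powr p * (1 - x) powr (q + 1) * (s - x) powr \<gamma>)
      has_integral jacobi_int \<gamma> p q s - jacobi_int \<gamma> (p + 1) q s) {0..s}"
    by (rule has_integral_eq[rotated]) (use assms in \<open>auto simp: powr_add algebra_simps\<close>)
qed

text \<open>Integrates the derivative of \<open>x^(p+1) (1 - x)^q (s - x)^(\<gamma>+1)\<close>,
  which vanishes at both ends. The raised exponents keep every term a \<open>jacobi_int\<close> with
  the same \<open>\<gamma>\<close>.\<close>

lemma jacobi_parts:
  assumes p: "p > 0" and s: "0 < s" "s < 1"
  shows "(p + 1) * (s * jacobi_int \<gamma> p q s - jacobi_int \<gamma> (p + 1) q s)
    - q * (s * jacobi_int \<gamma> (p + 1) (q - 1) s - jacobi_int \<gamma> (p + 2) (q - 1) s)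
    - (\<gamma> + 1) * jacobi_int \<gamma> (p + 1) q s = 0"
proof -
  let ?f = "\<lambda>p q x. x powr p * (1 - x) powr q * (s - x) powr \<gamma>"
  let ?F = "\<lambda>x. x powr (p + 1) * (1 - x) powr q * (s - x) powr (\<gamma> + 1)"
  let ?F' = "\<lambda>x. (p + 1) * (s * ?f p q x - ?f (p + 1) q x)
    - q * (s * ?f (p + 1) (q - 1) x - ?f (p + 2) (q - 1) x) - (\<gamma> + 1) * ?f (p + 1) q x"
  have "(?F' has_integral (?F s - ?F 0)) {0..s}"
  proof (rule fundamental_theorem_of_calculus_interior)
    show "continuous_on {0..s} ?F"
      using p s \<gamma> by (intro continuous_intros continuous_on_powr') auto
    fix x assume "x \<in> {0<..<s}"
    then have x: "0 < x" "x < s" "x < 1" using s by auto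
    have "(?F has_real_derivative
        ((p + 1) * x powr p * (1 - x) powr q + x powr (p + 1) * (- (q * (1 - x) powr (q - 1)))) * (s - x) powr (\<gamma> + 1)
        + x powr (p + 1) * (1 - x) powr q * (- ((\<gamma> + 1) * (s - x) powr \<gamma>))) (at x)"
      using x by (auto intro!: derivative_eq_intros)
    moreover have "((p + 1) * x powr p * (1 - x) powr q + x powr (p + 1) * (- (q * (1 - x) powr (q - 1)))) * (s - x) powr (\<gamma> + 1)
        + x powr (p + 1) * (1 - x) powr q * (- ((\<gamma> + 1) * (s - x) powr \<gamma>)) = ?F' x"
    proof -
      have "x powr (p + 1) = x * x powr p" "x powr (p + 2) = x * (x * x powr p)"
        "(s - x) powr (\<gamma> + 1) = (s - x) * (s - x) powr \<gamma>"
        using x by (simp_all add: powr_add power2_eq_square)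
      then show ?thesis by (simp only:) (simp add: algebra_simps)
    qed
    ultimately show "(?F has_vector_derivative ?F' x) (at x)"
      by (simp only: has_real_derivative_iff_has_vector_derivative)
  qed (use s in simp)
  moreover have "(?F' has_integral ((p + 1) * (s * jacobi_int \<gamma> p q s - jacobi_int \<gamma> (p + 1) q s)
    - q * (s * jacobi_int \<gamma> (p + 1) (q - 1) s - jacobi_int \<gamma> (p + 2) (q - 1) s)
    - (\<gamma> + 1) * jacobi_int \<gamma> (p + 1) q s)) {0..s}"
    by (intro has_integral_diff has_integral_mult_right has_integral_jacobi) (use p s in auto)
  ultimately have "?F s - ?F 0 = (p + 1) * (s * jacobi_int \<gamma> p q s - jacobi_int \<gamma> (p + 1) q s)
    - q * (s * jacobi_int \<gamma> (p + 1) (q - 1) s - jacobi_int \<gamma> (p + 2) (q - 1) s)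
    - (\<gamma> + 1) * jacobi_int \<gamma> (p + 1) q s"
    by (rule has_integral_unique)
  then show ?thesis by simp
qed

text \<open>The substitution \<open>x = s u\<close> fixes the interval and replaces
  \<open>(s - x)^\<gamma>\<close>, whose \<open>s\<close>-derivative is singular at the endpoint for
  \<open>\<gamma> < 1\<close>, by \<open>(1 - s u)^q\<close>, smooth in \<open>s\<close>.\<close>

lemma jacobi_scale:
  assumes s: "0 < s" "s < 1"
  shows "jacobi_int \<gamma> p q s =
    s powr (p + \<gamma> + 1) * integral {0..1} (\<lambda>u. u powr p * (1 - s * u) powr q * (1 - u) powr \<gamma>)"
proof -
  let ?f = "\<lambda>x. x powr p * (1 - x) powr q * (s - x) powr \<gamma>"
  have img: "(\<lambda>x. x / s) ` {0..s} = {0..1}"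
    using s by (simp add: image_divide_atLeastAtMost)
  have "integral {0..1} (\<lambda>u. ?f (s * u)) = (1 / s) * integral {0..s} ?f"
    using integral_stretch_real[of s 0 s ?f] s by (simp add: img)
  moreover have "integral {0..1} (\<lambda>u. ?f (s * u)) =
      integral {0..1} (\<lambda>u. s powr (p + \<gamma>) * (u powr p * (1 - s * u) powr q * (1 - u) powr \<gamma>))"
  proof (rule integral_cong)
    fix u :: real assume u: "u \<in> {0..1}"
    have "s - s * u = s * (1 - u)" by (simp add: algebra_simps)
    then have "(s - s * u) powr \<gamma> = s powr \<gamma> * (1 - u) powr \<gamma>"
      using s u by (simp add: powr_mult)
    then show "?f (s * u) = s powr (p + \<gamma>) * (u powr p * (1 - s * u) powr q * (1 - u) powr \<gamma>)"
      using s u by (simp add: powr_mult powr_add)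
  qed
  moreover have "integral {0..1} (\<lambda>u. s powr (p + \<gamma>) * (u powr p * (1 - s * u) powr q * (1 - u) powr \<gamma>)) =
      s powr (p + \<gamma>) * integral {0..1} (\<lambda>u. u powr p * (1 - s * u) powr q * (1 - u) powr \<gamma>)"
    by (rule integral_mult_right)
  ultimately have "integral {0..s} ?f =
      s * (s powr (p + \<gamma>) * integral {0..1} (\<lambda>u. u powr p * (1 - s * u) powr q * (1 - u) powr \<gamma>))"
    using s by simp
  moreover have "s powr (p + \<gamma> + 1) = s * s powr (p + \<gamma>)"
    using s by (simp add: powr_add)
  ultimately show ?thesis
    by (simp only: jacobi_int_def mult.assoc)
qed

text \<open>Differentiation under the integral sign after scaling lowers \<open>q\<close> to
  \<open>q - 1\<close>; \<open>jacobi_parts\<close> and \<open>jacobi_contiguous\<close> restore the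
  exponent \<open>q\<close>.\<close>

lemma DERIV_jacobi_int:
  assumes p: "p > 0" and s: "0 < s" "s < 1"
  shows "((\<lambda>s. jacobi_int \<gamma> p q s) has_real_derivative
    ((p + 1 + \<gamma> * (1 - s)) * jacobi_int \<gamma> p q s - (p + q + \<gamma> + 2) * jacobi_int \<gamma> (p + 1) q s) / (s * (1 - s))) (at s)"
proof -
  define G where "G p q s = integral {0..1} (\<lambda>u. u powr p * (1 - s * u) powr q * (1 - u) powr \<gamma>)" for p q s :: real
  \<comment> \<open>Keeps \<open>1 - s u\<close> positive on the closed \<open>u\<close>-interval,
    so a negative exponent \<open>q - 1\<close> does no harm.\<close>
  have less: "s * u < 1" if "0 < s" "s < 1" "0 \<le> u" "u \<le> 1" for s u :: real
    using that mult_left_le[of u s] le_less_trans[of "s * u" s 1] by auto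
  then have le: "s * u \<le> 1" and ne: "s * u \<noteq> 1" if "0 < s" "s < 1" "0 \<le> u" "u \<le> 1" for s u :: real
    using that less_imp_le less_irrefl by metis+
  have "((\<lambda>s. integral (cbox 0 1) (\<lambda>u. u powr p * (1 - s * u) powr q * (1 - u) powr \<gamma>)) has_field_derivative
      integral (cbox 0 1) (\<lambda>u. - q * (u powr (p + 1) * (1 - s * u) powr (q - 1) * (1 - u) powr \<gamma>))) (at s within {0<..<1})"
  proof (rule leibniz_rule_field_derivative[where fx = "\<lambda>s u. - q * (u powr (p + 1) * (1 - s * u) powr (q - 1) * (1 - u) powr \<gamma>)"])
    fix s u :: real assume su: "s \<in> {0<..<1}" "u \<in> cbox 0 1"
    then have 1: "1 - s * u > 0" using less by simp
    have "((\<lambda>s. u powr p * (1 - s * u) powr q * (1 - u) powr \<gamma>) has_real_derivative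
        u powr p * (- u * (q * (1 - s * u) powr (q - 1))) * (1 - u) powr \<gamma>) (at s within {0<..<1})"
      using 1 by (auto intro!: derivative_eq_intros)
    moreover have "u powr (p + 1) = u powr p * u"
      using su by (simp add: powr_add)
    ultimately show "((\<lambda>s. u powr p * (1 - s * u) powr q * (1 - u) powr \<gamma>) has_field_derivative
        - q * (u powr (p + 1) * (1 - s * u) powr (q - 1) * (1 - u) powr \<gamma>)) (at s within {0<..<1})"
      by (simp add: algebra_simps)
  next
    fix s :: real assume "s \<in> {0<..<1}"
    then show "(\<lambda>u. u powr p * (1 - s * u) powr q * (1 - u) powr \<gamma>) integrable_on cbox 0 1"
      using p \<gamma>
      by (intro integrable_continuous continuous_intros continuous_on_powr') (auto simp: le ne)
  next
    show "continuous_on ({0<..<1} \<times> cbox 0 1)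
        (\<lambda>(s, u). - q * (u powr (p + 1) * (1 - s * u) powr (q - 1) * (1 - u) powr \<gamma>))"
      unfolding split_beta
      using p \<gamma> by (intro continuous_intros continuous_on_powr') (auto simp: le ne)
  qed (use s in auto)
  then have "(G p q has_real_derivative - q * G (p + 1) (q - 1) s) (at s)"
    using s by (simp add: G_def[abs_def] at_within_open[of s "{0<..<1}"])
  then have "((\<lambda>s. s powr (p + \<gamma> + 1) * G p q s) has_real_derivative
      (p + \<gamma> + 1) * s powr (p + \<gamma>) * G p q s + s powr (p + \<gamma> + 1) * (- q * G (p + 1) (q - 1) s)) (at s)"
    using s by (auto intro!: derivative_eq_intros)
  moreover have "(p + \<gamma> + 1) * s powr (p + \<gamma>) * G p q s + s powr (p + \<gamma> + 1) * (- q * G (p + 1) (q - 1) s)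
      = ((p + \<gamma> + 1) * jacobi_int \<gamma> p q s - q * jacobi_int \<gamma> (p + 1) (q - 1) s) / s"
  proof -
    have J: "jacobi_int \<gamma> p q s = s powr (p + \<gamma> + 1) * G p q s" for p q
      unfolding G_def by (rule jacobi_scale[OF s])
    have "s powr (p + \<gamma> + 1) = s * s powr (p + \<gamma>)"
      "s powr (p + 1 + \<gamma> + 1) = s * (s * s powr (p + \<gamma>))"
      using s by (simp_all add: powr_add power2_eq_square)
    then show ?thesis
      unfolding J using s by (simp only:) (simp add: diff_divide_distrib)
  qed
  ultimately have *: "((\<lambda>s. s powr (p + \<gamma> + 1) * G p q s) has_real_derivative
      ((p + \<gamma> + 1) * jacobi_int \<gamma> p q s - q * jacobi_int \<gamma> (p + 1) (q - 1) s) / s) (at s)"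
    by (simp only:)
  have "jacobi_int \<gamma> (p + 2) (q - 1) s = jacobi_int \<gamma> (p + 1) (q - 1) s - jacobi_int \<gamma> (p + 1) q s"
    using jacobi_contiguous[of "p + 1" s "q - 1"] p s by (simp add: add.commute add.left_commute)
  then have "q * (1 - s) * jacobi_int \<gamma> (p + 1) (q - 1) s =
      (p + q + \<gamma> + 2) * jacobi_int \<gamma> (p + 1) q s - (p + 1) * s * jacobi_int \<gamma> p q s"
    using jacobi_parts[OF p s, of q] by (simp only:) (simp add: algebra_simps)
  then have "((p + \<gamma> + 1) * jacobi_int \<gamma> p q s - q * jacobi_int \<gamma> (p + 1) (q - 1) s) * (1 - s) =
      (p + 1 + \<gamma> * (1 - s)) * jacobi_int \<gamma> p q s - (p + q + \<gamma> + 2) * jacobi_int \<gamma> (p + 1) q s"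
    by (simp add: algebra_simps)
  note eq = this
  have "((p + \<gamma> + 1) * jacobi_int \<gamma> p q s - q * jacobi_int \<gamma> (p + 1) (q - 1) s) / s =
      ((p + \<gamma> + 1) * jacobi_int \<gamma> p q s - q * jacobi_int \<gamma> (p + 1) (q - 1) s) * (1 - s) / (s * (1 - s))"
    using s by simp
  note this[unfolded eq]
  with * have "((\<lambda>s. s powr (p + \<gamma> + 1) * G p q s) has_real_derivative
    ((p + 1 + \<gamma> * (1 - s)) * jacobi_int \<gamma> p q s - (p + q + \<gamma> + 2) * jacobi_int \<gamma> (p + 1) q s) / (s * (1 - s))) (at s)"
    by (simp only:)
  then show ?thesis
    by (rule DERIV_interval_cong[where a = 0 and b = 1]) (use s in \<open>auto simp: jacobi_scale G_def\<close>)
qed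

text \<open>\<open>jacobi_parts\<close> at \<open>q + 1\<close>, so that its lowered terms carry
  \<open>q\<close>; contiguity then removes \<open>q + 1\<close>.\<close>

lemma jacobi_recurrence:
  assumes p: "p > 0" and s: "0 < s" "s < 1"
  shows "(p + 1) * s * jacobi_int \<gamma> p q s
    - ((p + \<gamma> + 2) + (p + q + 2) * s) * jacobi_int \<gamma> (p + 1) q s
    + (p + q + \<gamma> + 3) * jacobi_int \<gamma> (p + 2) q s = 0"
proof -
  have E: "jacobi_int \<gamma> p (q + 1) s = jacobi_int \<gamma> p q s - jacobi_int \<gamma> (p + 1) q s"
    "jacobi_int \<gamma> (p + 1) (q + 1) s = jacobi_int \<gamma> (p + 1) q s - jacobi_int \<gamma> (p + 2) q s"
    using jacobi_contiguous[of p s q] jacobi_contiguous[of "p + 1" s q] p s by (simp_all add: add.commute)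
  from jacobi_parts[OF p s, of "q + 1"] show ?thesis
    unfolding E by (simp add: algebra_simps)
qed

end

section \<open>Positivity of weighted squares\<close>

lemma mfun_moments_has_integral:
  assumes "\<And>k. ((\<lambda>x. x ^ k * w x) has_integral m k) S"
  shows "((\<lambda>x. poly r x * w x) has_integral mfun m r) S"
proof -
  have "((\<lambda>x. \<Sum>i\<le>degree r. coeff r i * (x ^ i * w x)) has_integral mfun m r) S"
    unfolding mfun_def by (intro has_integral_sum has_integral_mult_right assms) simp
  then show ?thesis
    by (simp add: poly_altdef sum_distrib_right mult.assoc)
qed

lemma poly_zero_on_interval:
  fixes q :: "real poly"
  assumes "a < b" "\<And>x. x \<in> {a<..<b} \<Longrightarrow> poly q x = 0"
  shows "q = 0"
proof (rule ccontr)
  assume "q \<noteq> 0"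
  then have "finite {x. poly q x = 0}" by (rule poly_roots_finite)
  moreover have "{a<..<b} \<subseteq> {x. poly q x = 0}" using assms(2) by blast
  ultimately show False
    using infinite_Ioo[OF assms(1)] finite_subset by blast
qed

text \<open>The constant \<open>c\<close> is split off because the weight may vanish identically on
  one side of the jump. Strictness holds because a nonzero polynomial has finitely many
  roots.\<close>

lemma weighted_square_integral:
  fixes q :: "real poly"
  assumes ab: "a < b" and c: "c \<ge> 0" and v: "continuous_on {a..b} v"
    "\<And>x. x \<in> {a..b} \<Longrightarrow> v x \<ge> 0" "\<And>x. x \<in> {a<..<b} \<Longrightarrow> v x > 0"
    and w: "\<And>x. x \<in> {a..b} \<Longrightarrow> w x = c * v x"
    and i: "((\<lambda>x. poly (q * q) x * w x) has_integral i) {a..b}"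
  shows "i \<ge> 0" "c > 0 \<Longrightarrow> q \<noteq> 0 \<Longrightarrow> i > 0"
proof -
  let ?f = "\<lambda>x. poly q x * poly q x * w x"
  have nonneg: "?f x \<ge> 0" if "x \<in> {a..b}" for x
    using c v(2)[OF that] by (simp add: w[OF that])
  have i': "(?f has_integral i) {a..b}" using i by simp
  show i0: "i \<ge> 0" by (rule has_integral_nonneg[OF i' nonneg])
  assume c: "c > 0" and q: "q \<noteq> 0"
  have cont: "continuous_on {a..b} ?f"
    by (rule continuous_on_eq[of _ "\<lambda>x. poly q x * poly q x * (c * v x)"])
       (auto simp: w intro!: continuous_intros v)
  have "i \<noteq> 0"
  proof
    assume "i = 0"
    then have "integral {a..b} ?f = 0" using i' by (simp add: integral_unique)
    then have 0: "\<forall>x\<in>{a..b}. ?f x = 0"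
      using integral_eq_0_iff[OF cont ab nonneg] by blast
    have "poly q x = 0" if "x \<in> {a<..<b}" for x
    proof -
      have "?f x = 0" "w x \<noteq> 0" using 0 that c v(3)[OF that] by (auto simp: w)
      then show ?thesis by simp
    qed
    then show False using poly_zero_on_interval[OF ab] q by blast
  qed
  with i0 show "i > 0" by simp
qed

section \<open>Moments of the Jacobi weight with a jump at \<open>t\<close>\<close>

context
  fixes \<alpha> \<beta> \<gamma> A B :: real
  assumes pos: "\<alpha> > 0" "\<beta> > 0" "\<gamma> > 0"
begin

lemma wgt_left:
  "x \<in> {0..t} \<Longrightarrow> wgt \<alpha> \<beta> \<gamma> A B t x = A * (x powr \<alpha> * (1 - x) powr \<beta> * (t - x) powr \<gamma>)"
  by (simp add: wgt_def heaviside_def abs_minus_commute)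

text \<open>At \<open>x = t\<close> the Heaviside factor is 0 and the constants differ, but both
  sides vanish with \<open>(x - t) powr \<gamma>\<close>.\<close>

lemma wgt_right:
  "x \<in> {t..1} \<Longrightarrow> wgt \<alpha> \<beta> \<gamma> A B t x = (A + B) * (x powr \<alpha> * (1 - x) powr \<beta> * (x - t) powr \<gamma>)"
  using pos by (cases "x = t") (simp_all add: wgt_def heaviside_def)

lemma power_mult_powr: "x \<ge> 0 \<Longrightarrow> x ^ k * x powr a = x powr (a + real k)" for x a :: real
  by (cases "x = 0") (simp_all add: powr_add powr_realpow mult.commute)

lemma moment_left:
  assumes t: "0 < t" "t < 1"
  shows "((\<lambda>x. x ^ k * wgt \<alpha> \<beta> \<gamma> A B t x) has_integral A * jacobi_int \<gamma> (\<alpha> + k) \<beta> t) {0..t}"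
proof -
  have "((\<lambda>x. A * (x powr (\<alpha> + k) * (1 - x) powr \<beta> * (t - x) powr \<gamma>)) has_integral
      A * jacobi_int \<gamma> (\<alpha> + k) \<beta> t) {0..t}"
    by (intro has_integral_mult_right has_integral_jacobi) (use pos t in auto)
  then show ?thesis
    by (rule has_integral_eq[rotated]) (auto simp: wgt_left simp flip: power_mult_powr)
qed

lemma moment_right:
  assumes t: "0 < t" "t < 1"
  shows "((\<lambda>x. x ^ k * wgt \<alpha> \<beta> \<gamma> A B t x) has_integral (A + B) * jacobi_int \<gamma> \<beta> (\<alpha> + k) (1 - t)) {t..1}"
proof -
  have "((\<lambda>x. x powr \<beta> * (1 - x) powr (\<alpha> + k) * ((1 - t) - x) powr \<gamma>) has_integral
      jacobi_int \<gamma> \<beta> (\<alpha> + k) (1 - t)) {0..1 - t}"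
    by (intro has_integral_jacobi) (use pos t in auto)
  from has_integral_affinity[OF this[folded cbox_interval], of "-1" 1]
  have "((\<lambda>x. (1 - x) powr \<beta> * x powr (\<alpha> + k) * (x - t) powr \<gamma>) has_integral
      jacobi_int \<gamma> \<beta> (\<alpha> + k) (1 - t)) ((\<lambda>x. 1 - x) ` {0..1 - t})"
    by simp
  moreover have "(\<lambda>x. 1 - x) ` {0..1 - t} = {t..1}"
    by (simp add: image_diff_atLeastAtMost)
  ultimately have "((\<lambda>x. (A + B) * ((1 - x) powr \<beta> * x powr (\<alpha> + k) * (x - t) powr \<gamma>)) has_integral
      (A + B) * jacobi_int \<gamma> \<beta> (\<alpha> + k) (1 - t)) {t..1}"
    by (intro has_integral_mult_right) simp
  then show ?thesis
    by (rule has_integral_eq[rotated])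
       (use t in \<open>auto simp: wgt_right mult_ac simp flip: power_mult_powr\<close>)
qed

lemma moment_eq:
  assumes t: "0 < t" "t < 1"
  shows "moment \<alpha> \<beta> \<gamma> A B k t =
    A * jacobi_int \<gamma> (\<alpha> + k) \<beta> t + (A + B) * jacobi_int \<gamma> \<beta> (\<alpha> + k) (1 - t)"
  unfolding moment_def
  by (rule integral_unique, rule has_integral_combine[OF _ _ moment_left[OF t] moment_right[OF t]])
     (use t in auto)

text \<open>The relation \<open>gauss\<close> solved for the derivative; \<open>DERIV_moment\<close>
  shows that it is the derivative.\<close>

definition moment' :: "real \<Rightarrow> nat \<Rightarrow> real" where
  "moment' t k = ((k + 1 + \<alpha> + \<gamma> * (1 - t)) * moment \<alpha> \<beta> \<gamma> A B k t
    - (k + 2 + \<alpha> + \<beta> + \<gamma>) * moment \<alpha> \<beta> \<gamma> A B (Suc k) t) / (t * (1 - t))"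

text \<open>After reflection the moment index sits in the exponent of \<open>1 - x\<close>, so
  passing to the next moment is a contiguity step.\<close>

lemma jacobi_right_Suc:
  assumes "0 < t" "t < 1"
  shows "jacobi_int \<gamma> \<beta> (q + 1) (1 - t) = jacobi_int \<gamma> \<beta> q (1 - t) - jacobi_int \<gamma> (\<beta> + 1) q (1 - t)"
  using jacobi_contiguous[OF pos(3,2), of "1 - t" q] assms by simp

text \<open>The pieces over \<open>[0, t]\<close> and \<open>[t, 1]\<close> obey the same
  first-order relation, hence so does their combination with constants \<open>A\<close> and
  \<open>A + B\<close>.\<close>

lemma DERIV_moment:
  assumes t: "t \<in> {0<..<1}"
  shows "((\<lambda>s. moment \<alpha> \<beta> \<gamma> A B k s) has_real_derivative moment' t k) (at t)"
proof (rule DERIV_interval_cong[OF _ t])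
  have t': "0 < t" "t < 1" using t by auto
  let ?I = "\<lambda>k. jacobi_int \<gamma> (\<alpha> + k) \<beta> t" and ?J = "\<lambda>k. jacobi_int \<gamma> \<beta> (\<alpha> + k) (1 - t)"
  let ?u = "k + 1 + \<alpha> + \<gamma> * (1 - t)" and ?v = "k + 2 + \<alpha> + \<beta> + \<gamma>"
  show "moment \<alpha> \<beta> \<gamma> A B k s =
    A * jacobi_int \<gamma> (\<alpha> + k) \<beta> s + (A + B) * jacobi_int \<gamma> \<beta> (\<alpha> + k) (1 - s)" if "s \<in> {0<..<1}" for s
    using that by (simp add: moment_eq)
  have I: "((\<lambda>s. jacobi_int \<gamma> (\<alpha> + k) \<beta> s) has_real_derivative
      (?u * ?I k - ?v * ?I (Suc k)) / (t * (1 - t))) (at t)"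
    using DERIV_jacobi_int[OF pos(3), of "\<alpha> + k" t \<beta>] pos t by (simp add: algebra_simps)
  have J: "((\<lambda>s. jacobi_int \<gamma> \<beta> (\<alpha> + k) (1 - s)) has_real_derivative
      (?u * ?J k - ?v * ?J (Suc k)) / (t * (1 - t))) (at t)"
  proof -
    have "((\<lambda>s. jacobi_int \<gamma> \<beta> (\<alpha> + k) s) has_real_derivative
      ((\<beta> + 1 + \<gamma> * (1 - (1 - t))) * jacobi_int \<gamma> \<beta> (\<alpha> + k) (1 - t)
        - (\<beta> + (\<alpha> + k) + \<gamma> + 2) * jacobi_int \<gamma> (\<beta> + 1) (\<alpha> + k) (1 - t)) / ((1 - t) * (1 - (1 - t)))) (at (1 - t))"
      by (rule DERIV_jacobi_int) (use pos t in auto)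
    moreover have "((\<lambda>s. 1 - s) has_real_derivative - 1) (at t)"
      by (auto intro!: derivative_eq_intros)
    ultimately have "((\<lambda>s. jacobi_int \<gamma> \<beta> (\<alpha> + k) (1 - s)) has_real_derivative
      ((\<beta> + 1 + \<gamma> * (1 - (1 - t))) * jacobi_int \<gamma> \<beta> (\<alpha> + k) (1 - t)
        - (\<beta> + (\<alpha> + k) + \<gamma> + 2) * jacobi_int \<gamma> (\<beta> + 1) (\<alpha> + k) (1 - t)) / ((1 - t) * (1 - (1 - t))) * - 1) (at t)"
      by (rule DERIV_chain2)
    then have "((\<lambda>s. jacobi_int \<gamma> \<beta> (\<alpha> + k) (1 - s)) has_real_derivative
      ((\<beta> + 1 + \<gamma> * t) * jacobi_int \<gamma> \<beta> (\<alpha> + k) (1 - t)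
        - (\<beta> + (\<alpha> + k) + \<gamma> + 2) * jacobi_int \<gamma> (\<beta> + 1) (\<alpha> + k) (1 - t)) / ((1 - t) * t) * - 1) (at t)"
      by simp
    moreover have "?J (Suc k) = jacobi_int \<gamma> \<beta> (\<alpha> + k) (1 - t) - jacobi_int \<gamma> (\<beta> + 1) (\<alpha> + k) (1 - t)"
      using jacobi_right_Suc[OF t', of "\<alpha> + k"] by (simp add: add_ac)
    \<comment> \<open>The relation for the reflected piece has the opposite sign, absorbed by the
      inner derivative \<open>-1\<close> of \<open>1 - s\<close>.\<close>
    then have "?u * ?J k - ?v * ?J (Suc k) = - ((\<beta> + 1 + \<gamma> * t) * jacobi_int \<gamma> \<beta> (\<alpha> + k) (1 - t)
        - (\<beta> + (\<alpha> + k) + \<gamma> + 2) * jacobi_int \<gamma> (\<beta> + 1) (\<alpha> + k) (1 - t))"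
      by (simp only:) (simp add: algebra_simps)
    then have "(?u * ?J k - ?v * ?J (Suc k)) / (t * (1 - t)) = ((\<beta> + 1 + \<gamma> * t) * jacobi_int \<gamma> \<beta> (\<alpha> + k) (1 - t)
        - (\<beta> + (\<alpha> + k) + \<gamma> + 2) * jacobi_int \<gamma> (\<beta> + 1) (\<alpha> + k) (1 - t)) / ((1 - t) * t) * - 1"
      by (simp only: mult.commute[of t])
    ultimately show ?thesis by (simp only:)
  qed
  have "((\<lambda>s. A * jacobi_int \<gamma> (\<alpha> + k) \<beta> s + (A + B) * jacobi_int \<gamma> \<beta> (\<alpha> + k) (1 - s))
      has_real_derivative A * ((?u * ?I k - ?v * ?I (Suc k)) / (t * (1 - t)))
        + (A + B) * ((?u * ?J k - ?v * ?J (Suc k)) / (t * (1 - t)))) (at t)"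
    by (intro DERIV_add DERIV_cmult I J)
  moreover have "A * ((?u * ?I k - ?v * ?I (Suc k)) / (t * (1 - t)))
        + (A + B) * ((?u * ?J k - ?v * ?J (Suc k)) / (t * (1 - t))) = moment' t k"
    unfolding moment'_def moment_eq[OF t'] times_divide_eq_right add_divide_distrib[symmetric]
    by (rule arg_cong[of _ _ "\<lambda>x. x / _"]) (simp add: algebra_simps)
  ultimately show "((\<lambda>s. A * jacobi_int \<gamma> (\<alpha> + k) \<beta> s + (A + B) * jacobi_int \<gamma> \<beta> (\<alpha> + k) (1 - s))
      has_real_derivative moment' t k) (at t)"
    by (simp only:)
qed

lemma moment_recurrence:
  assumes t: "0 < t" "t < 1"
  shows "(\<alpha> + k + 1) * t * moment \<alpha> \<beta> \<gamma> A B k t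
    - ((\<alpha> + k + \<gamma> + 2) + (\<alpha> + k + \<beta> + 2) * t) * moment \<alpha> \<beta> \<gamma> A B (Suc k) t
    + (\<alpha> + k + \<beta> + \<gamma> + 3) * moment \<alpha> \<beta> \<gamma> A B (Suc (Suc k)) t = 0"
proof -
  let ?R = "\<lambda>x y z. (\<alpha> + k + 1) * t * x - ((\<alpha> + k + \<gamma> + 2) + (\<alpha> + k + \<beta> + 2) * t) * y + (\<alpha> + k + \<beta> + \<gamma> + 3) * z"
  let ?I = "\<lambda>k. jacobi_int \<gamma> (\<alpha> + real k) \<beta> t" and ?J = "\<lambda>k. jacobi_int \<gamma> \<beta> (\<alpha> + real k) (1 - t)"
  have I: "?R (?I k) (?I (Suc k)) (?I (Suc (Suc k))) = 0"
    using jacobi_recurrence[OF pos(3), of "\<alpha> + k" t \<beta>] pos t by (simp add: add_ac)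
  have J: "?R (?J k) (?J (Suc k)) (?J (Suc (Suc k))) = 0"
  proof -
    have 1: "?J (Suc k) = jacobi_int \<gamma> \<beta> (\<alpha> + k) (1 - t) - jacobi_int \<gamma> (\<beta> + 1) (\<alpha> + k) (1 - t)"
      using jacobi_right_Suc[OF t, of "\<alpha> + k"] by (simp add: add_ac)
    have "jacobi_int \<gamma> (\<beta> + 1) (\<alpha> + k + 1) (1 - t) =
        jacobi_int \<gamma> (\<beta> + 1) (\<alpha> + k) (1 - t) - jacobi_int \<gamma> (\<beta> + 2) (\<alpha> + k) (1 - t)"
      using jacobi_contiguous[OF pos(3), of "\<beta> + 1" "1 - t" "\<alpha> + k"] pos t by (simp add: add_ac)
    \<comment> \<open>Amounts to \<open>(1 - x)^2 = 1 - 2 x + x^2\<close> under the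
      integral.\<close>
    then have 2: "?J (Suc (Suc k)) = jacobi_int \<gamma> \<beta> (\<alpha> + k) (1 - t)
        - 2 * jacobi_int \<gamma> (\<beta> + 1) (\<alpha> + k) (1 - t) + jacobi_int \<gamma> (\<beta> + 2) (\<alpha> + k) (1 - t)"
      using jacobi_right_Suc[OF t, of "\<alpha> + k + 1"] 1 by (simp add: add_ac)
    show ?thesis
      unfolding 1 2 using jacobi_recurrence[OF pos(3,2), of "1 - t" "\<alpha> + k"] t
      by (simp add: algebra_simps)
  qed
  have "A * ?R (?I k) (?I (Suc k)) (?I (Suc (Suc k))) + (A + B) * ?R (?J k) (?J (Suc k)) (?J (Suc (Suc k))) = 0"
    unfolding I J by simp
  then show ?thesis
    unfolding moment_eq[OF t] by (simp add: algebra_simps)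
qed

lemma jacobi_moments_moment:
  assumes "A \<ge> 0" "A + B \<ge> 0" "\<not> (A = 0 \<and> A + B = 0)"
  shows "jacobi_moments \<alpha> \<beta> \<gamma> (\<lambda>t k. moment \<alpha> \<beta> \<gamma> A B k t) moment'"
proof
  fix t :: real and k :: nat
  assume "t \<in> {0<..<1}"
  then have t: "0 < t" "t < 1" by auto
  show "((\<lambda>s. moment \<alpha> \<beta> \<gamma> A B k s) has_real_derivative moment' t k) (at t)"
    by (rule DERIV_moment) fact
  have gauss: "t * (1 - t) * moment' t k =
      (k + 1 + \<alpha> + \<gamma> * (1 - t)) * moment \<alpha> \<beta> \<gamma> A B k t
      - (k + 2 + \<alpha> + \<beta> + \<gamma>) * moment \<alpha> \<beta> \<gamma> A B (Suc k) t" for k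
    using t by (simp add: moment'_def)
  then show "t * (1 - t) * moment' t k =
      (real k + 1 + \<alpha> + \<gamma> * (1 - t)) * moment \<alpha> \<beta> \<gamma> A B k t
      - (real k + 2 + \<alpha> + \<beta> + \<gamma>) * moment \<alpha> \<beta> \<gamma> A B (Suc k) t"
    by simp
  \<comment> \<open>Once \<open>gauss\<close> eliminates the derivatives, \<open>shift\<close> times
    \<open>t (1 - t)\<close> is the three-term recurrence of the moments.\<close>
  have "t * (1 - t) * moment' t (Suc k) - t * (t * (1 - t) * moment' t k)
      + \<gamma> * (t * (1 - t)) * moment \<alpha> \<beta> \<gamma> A B k t = 0"
    unfolding gauss using moment_recurrence[OF t, of k] by (simp add: algebra_simps)
  then have "t * (1 - t) * (moment' t (Suc k) - (t * moment' t k - \<gamma> * moment \<alpha> \<beta> \<gamma> A B k t)) = 0"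
    by (simp add: algebra_simps)
  then show "moment' t (Suc k) = t * moment' t k - \<gamma> * moment \<alpha> \<beta> \<gamma> A B k t"
    using t by simp
  fix q :: "real poly" assume q: "q \<noteq> 0"
  let ?w = "wgt \<alpha> \<beta> \<gamma> A B t"
  let ?l = "mfun (\<lambda>k. A * jacobi_int \<gamma> (\<alpha> + real k) \<beta> t) (q * q)"
  let ?r = "mfun (\<lambda>k. (A + B) * jacobi_int \<gamma> \<beta> (\<alpha> + real k) (1 - t)) (q * q)"
  have l: "((\<lambda>x. poly (q * q) x * ?w x) has_integral ?l) {0..t}"
    by (rule mfun_moments_has_integral) (rule moment_left[OF t])
  have r: "((\<lambda>x. poly (q * q) x * ?w x) has_integral ?r) {t..1}"
    by (rule mfun_moments_has_integral) (rule moment_right[OF t])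
  have cl: "continuous_on {0..t} (\<lambda>x. x powr \<alpha> * (1 - x) powr \<beta> * (t - x) powr \<gamma>)"
    using pos t by (intro continuous_intros continuous_on_powr') auto
  have cr: "continuous_on {t..1} (\<lambda>x. x powr \<alpha> * (1 - x) powr \<beta> * (x - t) powr \<gamma>)"
    using pos t by (intro continuous_intros continuous_on_powr') auto
  note L = weighted_square_integral[OF t(1) assms(1) cl _ _ wgt_left l]
  note R = weighted_square_integral[OF t(2) assms(2) cr _ _ wgt_right r]
  have "?l \<ge> 0" "?r \<ge> 0"
    by (rule L(1), use t in auto) (rule R(1), use t in auto)
  moreover have "A > 0 \<Longrightarrow> ?l > 0" "A + B > 0 \<Longrightarrow> ?r > 0"
    by (rule L(2), use t q in auto) (rule R(2), use t q in auto)
  moreover have "A > 0 \<or> A + B > 0" using assms by linarith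
  ultimately have "?l + ?r > 0" by linarith
  then show "mfun (\<lambda>k. moment \<alpha> \<beta> \<gamma> A B k t) (q * q) > 0"
    by (simp add: moment_eq[OF t] mfun_plus_moments)
qed

end

theorem theorem3p3:
  fixes \<alpha> \<beta> \<gamma> A B :: real and n :: nat
  assumes "\<alpha> > 0" "\<beta> > 0" "\<gamma> > 0"
    and "A \<ge> 0" "A + B \<ge> 0" "\<not> (A = 0 \<and> A + B = 0)"
    and "n \<ge> 1"
  shows "\<forall>t \<in> {0<..<1::real}.
    (let H = Hfun \<alpha> \<beta> \<gamma> A B n;
         h = H t; h1 = deriv H t; h2 = deriv (deriv H) t;
         c2 = 4 * n^2 + 4 * n * (\<alpha> + \<beta> + \<gamma>) + (\<alpha> + \<beta>)^2;
         c1 = 2 * n^2 + 2 * n * (\<alpha> + \<beta> + \<gamma>) + \<alpha> * (\<alpha> + \<gamma>) + \<beta> * (\<alpha> - \<gamma>);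
         m = n + \<alpha> + \<beta> + \<gamma>
     in (\<lambda>s. ln (hankelD \<alpha> \<beta> \<gamma> A B n s)) differentiable (at t)
      \<and> H differentiable (at t)
      \<and> deriv H differentiable (at t)
      \<and> t^2 * (t - 1)^2 * h2^2 + 4 * t * (t - 1) * h1^3
        - (4 * (2 * t - 1) * h + c2 * t^2 - 2 * c1 * t + (\<alpha> + \<gamma>)^2) * h1^2
        + 2 * (2 * h^2 + (c2 * t - c1) * h
               - n * \<gamma> * m * ((\<alpha> - \<beta>) * t - \<alpha> - \<gamma>)) * h1
        - c2 * h^2
        + 2 * n * \<gamma> * (\<alpha> - \<beta>) * m * h
        - n^2 * \<gamma>^2 * m^2 = 0)"
proof
  fix t :: real assume t: "t \<in> {0<..<1}"
  interpret jacobi_moments \<alpha> \<beta> \<gamma> "\<lambda>t k. moment \<alpha> \<beta> \<gamma> A B k t" "moment' \<alpha> \<beta> \<gamma> A B"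
    by (rule jacobi_moments_moment) fact+
  have D: "hankelD \<alpha> \<beta> \<gamma> A B n = D n"
    by (simp add: fun_eq_iff hankelD_def D_def hank_def)
  have "2 * real n + \<alpha> + \<beta> + \<gamma> \<noteq> 0"
    using assms(1-3) by (simp add: add_nonneg_pos less_imp_neq[THEN not_sym])
  from sigma_form[OF \<open>n \<ge> 1\<close> t this, of "Hfun \<alpha> \<beta> \<gamma> A B n"]
  show "let H = Hfun \<alpha> \<beta> \<gamma> A B n; h = H t; h1 = deriv H t; h2 = deriv (deriv H) t;
         c2 = 4 * n^2 + 4 * n * (\<alpha> + \<beta> + \<gamma>) + (\<alpha> + \<beta>)^2;
         c1 = 2 * n^2 + 2 * n * (\<alpha> + \<beta> + \<gamma>) + \<alpha> * (\<alpha> + \<gamma>) + \<beta> * (\<alpha> - \<gamma>);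
         m = n + \<alpha> + \<beta> + \<gamma>
     in (\<lambda>s. ln (hankelD \<alpha> \<beta> \<gamma> A B n s)) differentiable (at t)
      \<and> H differentiable (at t)
      \<and> deriv H differentiable (at t)
      \<and> t^2 * (t - 1)^2 * h2^2 + 4 * t * (t - 1) * h1^3
        - (4 * (2 * t - 1) * h + c2 * t^2 - 2 * c1 * t + (\<alpha> + \<gamma>)^2) * h1^2
        + 2 * (2 * h^2 + (c2 * t - c1) * h
               - n * \<gamma> * m * ((\<alpha> - \<beta>) * t - \<alpha> - \<gamma>)) * h1
        - c2 * h^2
        + 2 * n * \<gamma> * (\<alpha> - \<beta>) * m * h
        - n^2 * \<gamma>^2 * m^2 = 0"
    by (simp add: Let_def Hfun_def D)
qed

end
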